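(* Let $p\ge2$ and let $S=(S_1,\dots,S_p)\sim\mathrm{Dirichlet}(1/2,\dots,1/2)$. Then, for every fixed simplex vector $w=(w_1,\dots,w_p)$ ($w_j\ge0$, $\sum_j w_j=1$), $$D_{\chi^2}(w\Vert S)\sim\mathrm{BetaPrime}\Bigl(\tfrac{p-1}2,\tfrac12\Bigr)\overset{d}{=}\frac{\chi^2_{p-1}}{\chi^2_1}=(p-1)F_{p-1,1},$$ where the two chi-square variables are independent.
   Context: For a probability vector $w$ and a probability vector $s$ with positive coordinates, the Pearson divergence is $$D_{\chi^2}(w\Vert s):=\sum_{j=1}^p\frac{(w_j-s_j)^2}{s_j}=\sum_{j=1}^p\frac{w_j^2}{s_j}-1 .$$ $\mathrm{BetaPrime}(\alpha,\beta)$ is the law of $X/(1-X)$ for $X\sim\mathrm{Beta}(\alpha,\beta)$, and $F_{m,n}$ denotes an $F$-distributed variable with $(m,n)$ degrees of freedom. *)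

theory Defs
  imports "HOL-Probability.Probability"
begin

text \<open>Vectors of length \<open>p\<close> are functions on the index set \<open>{1..p}\<close>.\<close>

definition prob_vector :: "nat \<Rightarrow> (nat \<Rightarrow> real) \<Rightarrow> bool" where
  "prob_vector p w \<longleftrightarrow> (\<forall>j\<in>{1..p}. 0 \<le> w j) \<and> (\<Sum>j=1..p. w j) = 1"

definition pearson_divergence :: "nat \<Rightarrow> (nat \<Rightarrow> real) \<Rightarrow> (nat \<Rightarrow> real) \<Rightarrow> real" where
  "pearson_divergence p w s = (\<Sum>j=1..p. (w j - s j)\<^sup>2 / s j)"

text \<open>
  The Dirichlet law is singular with respect to Lebesgue measure on the full space, so, as usual,
  the density is that of the first \<open>p - 1\<close> coordinates, and the last coordinate is one minus
  their sum.
\<close>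

definition simplex_last :: "nat \<Rightarrow> (nat \<Rightarrow> real) \<Rightarrow> real" where
  "simplex_last p x = 1 - (\<Sum>j\<in>{1..<p}. x j)"

definition dirichlet_density :: "nat \<Rightarrow> (nat \<Rightarrow> real) \<Rightarrow> (nat \<Rightarrow> real) \<Rightarrow> real" where
  "dirichlet_density p \<alpha> x =
    (if (\<forall>j\<in>{1..<p}. 0 < x j) \<and> 0 < simplex_last p x
     then Gamma (\<Sum>j=1..p. \<alpha> j) / (\<Prod>j=1..p. Gamma (\<alpha> j))
          * (\<Prod>j\<in>{1..<p}. x j powr (\<alpha> j - 1)) * simplex_last p x powr (\<alpha> p - 1)
     else 0)"

definition dirichlet :: "nat \<Rightarrow> (nat \<Rightarrow> real) \<Rightarrow> (nat \<Rightarrow> real) measure" where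
  "dirichlet p \<alpha> =
    distr (density (\<Pi>\<^sub>M j\<in>{1..<p}. lborel) (\<lambda>x. ennreal (dirichlet_density p \<alpha> x)))
      (\<Pi>\<^sub>M j\<in>{1..p}. borel)
      (\<lambda>x. \<lambda>j\<in>{1..p}. if j = p then simplex_last p x else x j)"

definition beta_distribution :: "real \<Rightarrow> real \<Rightarrow> real measure" where
  "beta_distribution a b =
    density lborel (\<lambda>x. ennreal
      (if 0 < x \<and> x < 1 then x powr (a - 1) * (1 - x) powr (b - 1) / Beta a b else 0))"

definition beta_prime_distribution :: "real \<Rightarrow> real \<Rightarrow> real measure" where
  "beta_prime_distribution a b = distr (beta_distribution a b) borel (\<lambda>x. x / (1 - x))"

definition chi_square_distribution :: "nat \<Rightarrow> real measure" where
  "chi_square_distribution k =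
    distr (\<Pi>\<^sub>M i\<in>{1..k}. density lborel std_normal_density) borel (\<lambda>z. \<Sum>i=1..k. (z i)\<^sup>2)"

text \<open>Here and below, a product measure expresses that the two variables are independent.\<close>

definition F_distribution :: "nat \<Rightarrow> nat \<Rightarrow> real measure" where
  "F_distribution m n =
    distr (chi_square_distribution m \<Otimes>\<^sub>M chi_square_distribution n) borel
      (\<lambda>(u, v). (u / real m) / (v / real n))"

definition chi_square_ratio_distribution :: "nat \<Rightarrow> nat \<Rightarrow> real measure" where
  "chi_square_ratio_distribution m n =
    distr (chi_square_distribution m \<Otimes>\<^sub>M chi_square_distribution n) borel (\<lambda>(u, v). u / v)"

end

theory Submission
  imports Defs
begin

text \<open>
  Let \<open>X\<^sub>1, \<dots>, X\<^sub>p\<close> be independent squares of standard normal variables, and let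
  \<open>Q = X\<^sub>1 + \<dots> + X\<^sub>p\<close>. The vector \<open>X / Q\<close> has the Dirichlet law with all parameters \<open>1/2\<close>
  (\<open>dirichlet_eq_normalized_gamma\<close>), and for weights \<open>w\<close> on the simplex the divergence of \<open>w\<close> from
  \<open>X / Q\<close> is \<open>Q * L - 1\<close> with \<open>L = (\<Sum>j. (w j)\<^sup>2 / X\<^sub>j)\<close>. So the divergence depends only on the pair
  \<open>(Q, L)\<close>, which is a sum of independent pairs \<open>(X\<^sub>j, (w j)\<^sup>2 / X\<^sub>j)\<close> in the plane.

  The heart of the matter is that two of these pairs with scales \<open>a\<close> and \<open>b\<close> have the same sum in law
  as two pairs with scales \<open>a + b\<close> and \<open>0\<close> (\<open>reciprocal_pair_convolution\<close>): a joint version of the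
  1/2-stability of the law of \<open>1 / X\<^sub>1\<close>. Associativity and commutativity of convolution then move
  the whole weight onto one index, so that the law of \<open>(Q, L)\<close> does not depend on \<open>w\<close>, and with all
  the weight on one index \<open>Q * L - 1\<close> is the ratio of the sum of the other \<open>p - 1\<close> squares to the
  square at that index. This is the ratio of independent chi-square variables with \<open>p - 1\<close> and
  \<open>1\<close> degrees of freedom.

  For two pairs, the total \<open>X\<^sub>1 + X\<^sub>2\<close> is independent of the proportion \<open>U = X\<^sub>1 / (X\<^sub>1 + X\<^sub>2)\<close>, which
  has the arcsine law \<open>Beta(1/2, 1/2)\<close> (\<open>gamma_beta_independent\<close>). It therefore suffices that
  \<open>a\<^sup>2 / U + b\<^sup>2 / (1 - U)\<close> and \<open>(a + b)\<^sup>2 / U\<close> have the same law (\<open>arcsine_inverse_sum\<close>). With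
  \<open>U = 1 / (1 + T\<^sup>2)\<close>, where \<open>T > 0\<close> is half-Cauchy, these variables are \<open>(a + b)\<^sup>2\<close> plus
  \<open>(a T - b / T)\<^sup>2\<close> and \<open>((a + b) T)\<^sup>2\<close> respectively, and the subtraction formula for the arctangent
  shows that Boole's transformation \<open>t \<mapsto> a t - b / t\<close> acts on Cauchy variables like multiplication
  by \<open>a + b\<close>.

  The same independence of total and proportion gives the additivity of gamma laws, hence the density of the
  chi-square laws, and identifies a ratio of independent gamma variables as beta prime.
\<close>

section \<open>Gamma, beta and beta prime laws\<close>

text \<open>
  The rate is \<open>1/2\<close>, so that the chi-square law with \<open>k\<close> degrees of freedom is \<open>gamma_law (k / 2)\<close>.
\<close>
definition gamma_dens :: "real \<Rightarrow> real \<Rightarrow> real" where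
  "gamma_dens a x = (if 0 < x then x powr (a - 1) * exp (- x / 2) / (2 powr a * Gamma a) else 0)"

definition gamma_law :: "real \<Rightarrow> real measure" where
  "gamma_law a = density lborel (\<lambda>x. ennreal (gamma_dens a x))"

definition beta_dens :: "real \<Rightarrow> real \<Rightarrow> real \<Rightarrow> real" where
  "beta_dens a b x = (if 0 < x \<and> x < 1 then x powr (a - 1) * (1 - x) powr (b - 1) / Beta a b else 0)"

lemma beta_distribution_eq: "beta_distribution a b = density lborel (\<lambda>x. ennreal (beta_dens a b x))"
  by (simp add: beta_distribution_def beta_dens_def)

lemma gamma_dens_measurable [measurable]: "gamma_dens a \<in> borel_measurable borel"
  unfolding gamma_dens_def by measurable

lemma beta_dens_measurable [measurable]: "beta_dens a b \<in> borel_measurable borel"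
  unfolding beta_dens_def by measurable

lemma gamma_dens_nonneg [simp]: "a > 0 \<Longrightarrow> 0 \<le> gamma_dens a x"
  by (auto simp: gamma_dens_def intro!: divide_nonneg_nonneg mult_nonneg_nonneg less_imp_le[OF Gamma_real_pos])

lemma Beta_real_pos: "a > 0 \<Longrightarrow> b > 0 \<Longrightarrow> Beta a b > (0::real)"
  by (simp add: Beta_def)

lemma beta_dens_nonneg [simp]: "a > 0 \<Longrightarrow> b > 0 \<Longrightarrow> 0 \<le> beta_dens a b x"
  using Beta_real_pos[of a b] by (auto simp: beta_dens_def)

lemma sets_gamma_law [simp, measurable_cong]: "sets (gamma_law a) = sets borel"
  by (simp add: gamma_law_def)
lemma space_gamma_law [simp]: "space (gamma_law a) = UNIV"
  by (simp add: gamma_law_def)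
lemma sets_beta_distribution [simp, measurable_cong]: "sets (beta_distribution a b) = sets borel"
  by (simp add: beta_distribution_def)
lemma space_beta_distribution [simp]: "space (beta_distribution a b) = UNIV"
  by (simp add: beta_distribution_def)

lemma sigma_finite_beta_distribution: "sigma_finite_measure (beta_distribution a b)"
  unfolding beta_distribution_eq
  by (subst sigma_finite_measure.sigma_finite_iff_density_finite)
    (auto intro: lborel.sigma_finite_measure_axioms)

lemma prob_space_gamma_law:
  assumes "a > 0" shows "prob_space (gamma_law a)"
proof
  let ?g = "\<lambda>t. ennreal (indicator {0..} t * t powr (a - 1) / exp t)"
  have "emeasure (gamma_law a) (space (gamma_law a)) = (\<integral>\<^sup>+x. ennreal (gamma_dens a x) \<partial>lborel)"
    by (simp add: gamma_law_def emeasure_density)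
  also have "\<dots> = (\<integral>\<^sup>+x. ennreal (2 * gamma_dens a (2 * x)) \<partial>lborel)"
    using assms by (subst nn_integral_real_affine[where c = 2 and t = 0])
      (auto simp: nn_integral_cmult[symmetric] ennreal_mult)
  also have "\<dots> = (\<integral>\<^sup>+x. ennreal (1 / Gamma a) * ?g x \<partial>lborel)"
  proof (rule nn_integral_cong_AE)
    show "AE x in lborel. ennreal (2 * gamma_dens a (2 * x)) = ennreal (1 / Gamma a) * ?g x"
      using AE_lborel_singleton[of "0::real"]
    proof eventually_elim
      case (elim x)
      have "2 * gamma_dens a (2 * x) = 1 / Gamma a * (indicator {0..} x * x powr (a - 1) / exp x)"
        using elim assms
        by (auto simp: gamma_dens_def powr_mult powr_diff exp_minus field_simps indicator_def)
      then show ?case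
        using assms by (simp flip: ennreal_mult')
    qed
  qed
  also have "\<dots> = ennreal (1 / Gamma a) * ennreal (Gamma a)"
    using assms by (subst nn_integral_cmult) (auto simp: Gamma_conv_nn_integral_real)
  also have "\<dots> = 1"
    using Gamma_real_pos[OF assms] by (simp flip: ennreal_mult')
  finally show "emeasure (gamma_law a) (space (gamma_law a)) = 1" .
qed

text \<open>
  Total and proportion of two independent gamma variables are independent. Both substitutions are affine:
  for fixed \<open>x\<close> the second variable is replaced by the total \<open>r = x + y\<close>, and after exchanging the order of
  integration \<open>x = r * u\<close> for fixed \<open>r\<close>. The joint density then factors into a function of \<open>r\<close> and
  one of \<open>u\<close>.
\<close>
lemma gamma_beta_independent:
  assumes "a > 0" "b > 0"
  shows "distr (gamma_law a \<Otimes>\<^sub>M gamma_law b) (borel \<Otimes>\<^sub>M borel) (\<lambda>(x, y). (x + y, x / (x + y)))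
    = gamma_law (a + b) \<Otimes>\<^sub>M beta_distribution a b" (is "?L = ?R")
proof (rule measure_eqI)
  show "sets ?L = sets ?R"
    by (simp cong: sets_pair_measure_cong)
next
  interpret A: prob_space "gamma_law a" by (rule prob_space_gamma_law) fact
  interpret B: prob_space "gamma_law b" by (rule prob_space_gamma_law) fact
  interpret bt: sigma_finite_measure "beta_distribution a b" by (rule sigma_finite_beta_distribution)
  fix X assume "X \<in> sets ?L"
  then have X[measurable]: "X \<in> sets (borel \<Otimes>\<^sub>M borel)" by simp
  let ?f = "indicator X :: real \<times> real \<Rightarrow> ennreal"
  have dens: "r * (gamma_dens a (r * u) * gamma_dens b (r - r * u)) = gamma_dens (a + b) r * beta_dens a b u"
    if "r > 0" for r u
  proof (cases "0 < u \<and> u < 1")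
    case True
    then have pos: "0 < r * u" "0 < r * (1 - u)" using that by auto
    have diff: "r - r * u = r * (1 - u)" by (simp add: algebra_simps)
    have exps: "exp (- (r * u) / 2) * exp (- (r * (1 - u)) / 2) = exp (- r / 2)"
      by (simp add: field_simps flip: exp_add)
    have powrs: "r * ((r * u) powr (a - 1) * (r * (1 - u)) powr (b - 1))
        = r powr (a + b - 1) * (u powr (a - 1) * (1 - u) powr (b - 1))"
    proof -
      have "r powr (a + b - 1) = r * (r powr (a - 1) * r powr (b - 1))"
        using that powr_add[of r 1 "(a - 1) + (b - 1)"] by (simp add: powr_add[symmetric])
      then show ?thesis using that True by (simp add: powr_mult)
    qed
    have "r * (gamma_dens a (r * u) * gamma_dens b (r - r * u))
       = (r * ((r * u) powr (a - 1) * (r * (1 - u)) powr (b - 1)))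
          * (exp (- (r * u) / 2) * exp (- (r * (1 - u)) / 2))
          / (2 powr a * Gamma a * (2 powr b * Gamma b))"
      unfolding diff using pos by (simp add: gamma_dens_def)
    also have "\<dots> = r powr (a + b - 1) * (u powr (a - 1) * (1 - u) powr (b - 1)) * exp (- r / 2)
          / (2 powr a * Gamma a * (2 powr b * Gamma b))"
      unfolding exps powrs ..
    also have "\<dots> = gamma_dens (a + b) r * beta_dens a b u"
      using that True less_imp_neq[OF Gamma_real_pos[of "a + b"], symmetric] assms
      by (simp add: gamma_dens_def beta_dens_def Beta_def powr_add mult_ac)
    finally show ?thesis .
  next
    case False
    then have "\<not> (0 < r * u \<and> 0 < r * (1 - u))"
      using that by (auto simp: zero_less_mult_iff)
    then have "\<not> (0 < r * u \<and> 0 < r - r * u)"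
      by (simp add: algebra_simps)
    then show ?thesis
      using False by (auto simp: gamma_dens_def beta_dens_def)
  qed
  have "emeasure ?L X = (\<integral>\<^sup>+z. ?f (case z of (x, y) \<Rightarrow> (x + y, x / (x + y))) \<partial>(gamma_law a \<Otimes>\<^sub>M gamma_law b))"
    by (subst nn_integral_indicator[symmetric, of X "?L"])
      (simp_all add: nn_integral_distr del: nn_integral_indicator)
  also have "\<dots> = (\<integral>\<^sup>+x. \<integral>\<^sup>+y. ?f (x + y, x / (x + y)) \<partial>gamma_law b \<partial>gamma_law a)"
    by (subst B.nn_integral_fst[symmetric]) auto
  also have "\<dots> = (\<integral>\<^sup>+x. \<integral>\<^sup>+y. ennreal (gamma_dens a x * gamma_dens b y) * ?f (x + y, x / (x + y)) \<partial>lborel \<partial>lborel)"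
    using assms unfolding gamma_law_def
    by (simp add: nn_integral_density nn_integral_cmult[symmetric] ennreal_mult mult.assoc)
  also have "\<dots> = (\<integral>\<^sup>+x. \<integral>\<^sup>+r. ennreal (gamma_dens a x * gamma_dens b (r - x)) * ?f (r, x / r) \<partial>lborel \<partial>lborel)"
  proof (rule nn_integral_cong)
    fix x :: real
    show "(\<integral>\<^sup>+y. ennreal (gamma_dens a x * gamma_dens b y) * ?f (x + y, x / (x + y)) \<partial>lborel)
      = (\<integral>\<^sup>+r. ennreal (gamma_dens a x * gamma_dens b (r - x)) * ?f (r, x / r) \<partial>lborel)"
      by (subst nn_integral_real_affine[where c = 1 and t = "- x"]) simp_all
  qed
  also have "\<dots> = (\<integral>\<^sup>+r. \<integral>\<^sup>+x. ennreal (gamma_dens a x * gamma_dens b (r - x)) * ?f (r, x / r) \<partial>lborel \<partial>lborel)"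
    by (rule lborel_pair.Fubini'[symmetric]) measurable
  also have "\<dots> = (\<integral>\<^sup>+r. \<integral>\<^sup>+u. ennreal (gamma_dens (a + b) r * beta_dens a b u) * ?f (r, u) \<partial>lborel \<partial>lborel)"
  proof (rule nn_integral_cong)
    fix r :: real
    show "(\<integral>\<^sup>+x. ennreal (gamma_dens a x * gamma_dens b (r - x)) * ?f (r, x / r) \<partial>lborel)
      = (\<integral>\<^sup>+u. ennreal (gamma_dens (a + b) r * beta_dens a b u) * ?f (r, u) \<partial>lborel)"
    proof (cases "r > 0")
      case True
      have "(\<integral>\<^sup>+x. ennreal (gamma_dens a x * gamma_dens b (r - x)) * ?f (r, x / r) \<partial>lborel)
        = (\<integral>\<^sup>+u. ennreal r * (ennreal (gamma_dens a (r * u) * gamma_dens b (r - r * u)) * ?f (r, u)) \<partial>lborel)"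
        using True by (subst nn_integral_real_affine[where c = r and t = 0])
          (simp_all add: nn_integral_cmult)
      also have "\<dots> = (\<integral>\<^sup>+u. ennreal (gamma_dens (a + b) r * beta_dens a b u) * ?f (r, u) \<partial>lborel)"
        using True assms by (simp add: dens[symmetric] ennreal_mult mult.assoc)
      finally show ?thesis .
    next
      case False
      then have "gamma_dens a x * gamma_dens b (r - x) = 0" for x
        by (auto simp: gamma_dens_def)
      then show ?thesis using False by (simp only: ennreal_0 mult_zero_left) (simp add: gamma_dens_def)
    qed
  qed
  also have "\<dots> = (\<integral>\<^sup>+r. \<integral>\<^sup>+u. ?f (r, u) \<partial>beta_distribution a b \<partial>gamma_law (a + b))"
    using assms unfolding gamma_law_def beta_distribution_eq
    by (simp add: nn_integral_density nn_integral_cmult[symmetric] ennreal_mult mult.assoc)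
  also have "\<dots> = emeasure ?R X"
    by (subst bt.nn_integral_fst) (simp_all cong: sets_pair_measure_cong)
  finally show "emeasure ?L X = emeasure ?R X" .
qed

text \<open>
  The total mass of the beta law is read off from \<open>gamma_beta_independent\<close>: the other three
  measures have mass one.
\<close>
lemma prob_space_beta_distribution:
  assumes "a > 0" "b > 0" shows "prob_space (beta_distribution a b)"
proof
  interpret A: prob_space "gamma_law a" by (rule prob_space_gamma_law) fact
  interpret B: prob_space "gamma_law b" by (rule prob_space_gamma_law) fact
  interpret AB: prob_space "gamma_law (a + b)" using assms by (intro prob_space_gamma_law) auto
  interpret P: pair_prob_space "gamma_law a" "gamma_law b" ..
  interpret bt: sigma_finite_measure "beta_distribution a b" by (rule sigma_finite_beta_distribution)
  have "prob_space (gamma_law (a + b) \<Otimes>\<^sub>M beta_distribution a b)"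
    unfolding gamma_beta_independent[OF assms, symmetric]
    by (rule P.prob_space_distr) measurable
  then have "emeasure (gamma_law (a + b) \<Otimes>\<^sub>M beta_distribution a b) (UNIV \<times> UNIV) = 1"
    using prob_space.emeasure_space_1 by (fastforce simp: space_pair_measure)
  then show "emeasure (beta_distribution a b) (space (beta_distribution a b)) = 1"
    using AB.emeasure_space_1 by (subst (asm) bt.emeasure_pair_measure_Times) auto
qed

lemma AE_gamma_law_pos: "a > 0 \<Longrightarrow> AE x in gamma_law a. 0 < x"
  unfolding gamma_law_def by (subst AE_density) (auto simp: gamma_dens_def)

lemma AE_gamma_law_pair_pos:
  assumes "a > 0" "b > 0"
  shows "AE z in gamma_law a \<Otimes>\<^sub>M gamma_law b. 0 < fst z \<and> 0 < snd z"
proof -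
  interpret A: prob_space "gamma_law a" by (rule prob_space_gamma_law) fact
  interpret B: prob_space "gamma_law b" by (rule prob_space_gamma_law) fact
  interpret P: pair_prob_space "gamma_law a" "gamma_law b" ..
  show ?thesis
  proof (rule P.AE_pair_measure)
    show "{z \<in> space (gamma_law a \<Otimes>\<^sub>M gamma_law b). 0 < fst z \<and> 0 < snd z}
        \<in> sets (gamma_law a \<Otimes>\<^sub>M gamma_law b)"
      by measurable
    show "AE x in gamma_law a. AE y in gamma_law b. 0 < fst (x, y) \<and> 0 < snd (x, y)"
      using AE_gamma_law_pos[OF assms(1)] AE_gamma_law_pos[OF assms(2)] by auto
  qed
qed

lemma AE_beta_distribution: "a > 0 \<Longrightarrow> b > 0 \<Longrightarrow> AE x in beta_distribution a b. 0 < x \<and> x < 1"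
  unfolding beta_distribution_eq by (subst AE_density) (auto simp: beta_dens_def)

lemma beta_distribution_reflect:
  assumes "a > 0" "b > 0"
  shows "distr (beta_distribution a b) borel (\<lambda>x. 1 - x) = beta_distribution b a" (is "?L = ?R")
proof (rule measure_eqI)
  show "sets ?L = sets ?R" by simp
  fix X assume "X \<in> sets ?L"
  then have [measurable]: "X \<in> sets borel" by simp
  have sym: "beta_dens a b (1 - x) = beta_dens b a x" for x
    by (auto simp: beta_dens_def Beta_commute mult.commute)
  have "emeasure ?L X = (\<integral>\<^sup>+x. indicator X (1 - x) \<partial>beta_distribution a b)"
    by (subst nn_integral_indicator[symmetric, of X ?L]) (simp_all add: nn_integral_distr del: nn_integral_indicator)
  also have "\<dots> = (\<integral>\<^sup>+x. ennreal (beta_dens a b x) * indicator X (1 - x) \<partial>lborel)"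
    by (simp add: beta_distribution_eq nn_integral_density)
  also have "\<dots> = (\<integral>\<^sup>+x. ennreal (beta_dens b a x) * indicator X x \<partial>lborel)"
    by (subst nn_integral_real_affine[where c = "-1" and t = 1]) (simp_all add: sym)
  also have "\<dots> = emeasure ?R X"
    by (simp add: beta_distribution_eq emeasure_density)
  finally show "emeasure ?L X = emeasure ?R X" .
qed

lemma gamma_law_add:
  assumes "a > 0" "b > 0"
  shows "distr (gamma_law a \<Otimes>\<^sub>M gamma_law b) borel (\<lambda>(x, y). x + y) = gamma_law (a + b)"
proof -
  interpret bt: prob_space "beta_distribution a b" by (rule prob_space_beta_distribution) fact+
  have "distr (gamma_law a \<Otimes>\<^sub>M gamma_law b) borel (\<lambda>(x, y). x + y)
      = distr (distr (gamma_law a \<Otimes>\<^sub>M gamma_law b) (borel \<Otimes>\<^sub>M borel) (\<lambda>(x, y). (x + y, x / (x + y)))) borel fst"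
    by (subst distr_distr) (auto simp: comp_def case_prod_beta')
  also have "\<dots> = distr (gamma_law (a + b) \<Otimes>\<^sub>M beta_distribution a b) (gamma_law (a + b)) fst"
    unfolding gamma_beta_independent[OF assms] by (rule distr_cong) simp_all
  also have "\<dots> = gamma_law (a + b)"
    by (rule bt.distr_pair_fst)
  finally show ?thesis .
qed

text \<open>
  A ratio \<open>x / y\<close> is the odds \<open>u / (1 - u)\<close> of the proportion \<open>u = x / (x + y)\<close>.
\<close>
lemma beta_prime_eq_gamma_ratio:
  assumes "a > 0" "b > 0"
  shows "beta_prime_distribution a b = distr (gamma_law a \<Otimes>\<^sub>M gamma_law b) borel (\<lambda>(x, y). x / y)"
proof -
  interpret AB: prob_space "gamma_law (a + b)" using assms by (intro prob_space_gamma_law) auto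
  interpret bt: prob_space "beta_distribution a b" by (rule prob_space_beta_distribution) fact+
  have snd: "distr (gamma_law (a + b) \<Otimes>\<^sub>M beta_distribution a b) borel snd = beta_distribution a b"
  proof (rule measure_eqI)
    fix X assume "X \<in> sets (distr (gamma_law (a + b) \<Otimes>\<^sub>M beta_distribution a b) borel snd)"
    then have X[measurable]: "X \<in> sets borel" by simp
    have "snd -` X \<inter> space (gamma_law (a + b) \<Otimes>\<^sub>M beta_distribution a b) = space (gamma_law (a + b)) \<times> X"
      by (auto simp: space_pair_measure)
    then show "emeasure (distr (gamma_law (a + b) \<Otimes>\<^sub>M beta_distribution a b) borel snd) X
        = emeasure (beta_distribution a b) X"
      using AB.emeasure_space_1 by (simp add: emeasure_distr bt.emeasure_pair_measure_Times)
  qed simp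
  have "beta_prime_distribution a b
     = distr (distr (gamma_law (a + b) \<Otimes>\<^sub>M beta_distribution a b) borel snd) borel (\<lambda>x. x / (1 - x))"
    by (simp add: beta_prime_distribution_def snd)
  also have "\<dots> = distr (gamma_law a \<Otimes>\<^sub>M gamma_law b) borel (\<lambda>(x, y). x / (x + y) / (1 - x / (x + y)))"
    unfolding gamma_beta_independent[OF assms, symmetric]
    by (subst distr_distr, simp, simp, subst distr_distr) (auto simp: comp_def case_prod_beta')
  also have "\<dots> = distr (gamma_law a \<Otimes>\<^sub>M gamma_law b) borel (\<lambda>(x, y). x / y)"
  proof (rule distr_cong_AE)
    show "AE z in gamma_law a \<Otimes>\<^sub>M gamma_law b.
        (case z of (x, y) \<Rightarrow> x / (x + y) / (1 - x / (x + y))) = (case z of (x, y) \<Rightarrow> x / y)"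
      using AE_gamma_law_pair_pos[OF assms]
    proof eventually_elim
      case (elim z)
      then have "1 - fst z / (fst z + snd z) = snd z / (fst z + snd z)"
        by (simp add: field_simps)
      then show ?case using elim by (simp add: case_prod_beta)
    qed
  qed simp_all
  finally show ?thesis .
qed

section \<open>Chi-square laws\<close>

lemma prob_space_gamma_PiM:
  assumes "\<And>j. j \<in> J \<Longrightarrow> \<alpha> j > 0" shows "prob_space (\<Pi>\<^sub>M j\<in>J. gamma_law (\<alpha> j))"
  using assms by (intro prob_space_PiM prob_space_gamma_law) auto

text \<open>
  Splitting off an independent coordinate turns a sum over an index set into a convolution. This is the
  induction step for sums of gamma variables and for sums of pairs.
\<close>
lemma distr_PiM_insert:
  assumes "\<And>j. j \<in> insert k J \<Longrightarrow> prob_space (M j)"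
    and "f \<in> measurable (PiM (insert k J) M) N"
  shows "distr (PiM (insert k J) M) N f = distr (M k \<Otimes>\<^sub>M PiM J M) N (\<lambda>(x, X). f (X(k := x)))"
proof -
  have "distr (PiM (insert k J) M) N f
     = distr (distr (M k \<Otimes>\<^sub>M PiM J M) (PiM (insert k J) M) (\<lambda>(x, X). X(k := x))) N f"
    using assms(1) by (subst distr_pair_PiM_eq_PiM) auto
  also have "\<dots> = distr (M k \<Otimes>\<^sub>M PiM J M) N (\<lambda>(x, X). f (X(k := x)))"
    using assms(2) by (subst distr_distr) (auto simp: comp_def case_prod_beta')
  finally show ?thesis .
qed

lemma gamma_law_sum:
  assumes "finite J" "J \<noteq> {}" "\<And>j. j \<in> J \<Longrightarrow> \<alpha> j > 0"
  shows "distr (\<Pi>\<^sub>M j\<in>J. gamma_law (\<alpha> j)) borel (\<lambda>x. \<Sum>j\<in>J. x j) = gamma_law (\<Sum>j\<in>J. \<alpha> j)"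
  using assms
proof (induction J rule: finite_ne_induct)
  case (singleton k)
  have "distr (\<Pi>\<^sub>M j\<in>{k}. gamma_law (\<alpha> j)) borel (\<lambda>x. x k)
     = distr (\<Pi>\<^sub>M j\<in>{k}. gamma_law (\<alpha> j)) (gamma_law (\<alpha> k)) (\<lambda>x. x k)"
    by (rule distr_cong) simp_all
  also have "\<dots> = gamma_law (\<alpha> k)"
    using singleton by (intro distr_PiM_component prob_space_gamma_law) auto
  finally show ?case by simp
next
  case (insert k J)
  let ?P = "\<Pi>\<^sub>M j\<in>J. gamma_law (\<alpha> j)"
  have pos: "(\<Sum>j\<in>J. \<alpha> j) > 0" using insert by (intro sum_pos) auto
  have sum_upd: "(\<Sum>j\<in>J. (X(k := x)) j) = (\<Sum>j\<in>J. X j)" for X :: "'a \<Rightarrow> real" and x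
    using insert by (intro sum.cong) auto
  have sf: "sigma_finite_measure (distr ?P borel (\<lambda>x. \<Sum>j\<in>J. x j))"
    using insert by (intro prob_space_imp_sigma_finite prob_space.prob_space_distr prob_space_gamma_PiM) auto
  have "distr (\<Pi>\<^sub>M j\<in>insert k J. gamma_law (\<alpha> j)) borel (\<lambda>x. \<Sum>j\<in>insert k J. x j)
     = distr (gamma_law (\<alpha> k) \<Otimes>\<^sub>M ?P) borel (\<lambda>(x, X). \<Sum>j\<in>insert k J. (X(k := x)) j)"
    using insert by (subst distr_PiM_insert) (auto intro: prob_space_gamma_law)
  also have "\<dots> = distr (gamma_law (\<alpha> k) \<Otimes>\<^sub>M ?P) borel (\<lambda>(x, X). x + (\<Sum>j\<in>J. X j))"
    using insert by (simp add: sum_upd fun_upd_same del: fun_upd_apply)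
  also have "\<dots> = distr (distr (gamma_law (\<alpha> k)) borel (\<lambda>x. x) \<Otimes>\<^sub>M distr ?P borel (\<lambda>x. \<Sum>j\<in>J. x j)) borel (\<lambda>(x, y). x + y)"
    using sf by (subst pair_measure_distr) (auto simp: distr_distr comp_def case_prod_beta')
  also have "distr (gamma_law (\<alpha> k)) borel (\<lambda>x. x) = gamma_law (\<alpha> k)"
    by (rule distr_id2) simp
  also have "distr ?P borel (\<lambda>x. \<Sum>j\<in>J. x j) = gamma_law (\<Sum>j\<in>J. \<alpha> j)"
    using insert by auto
  also have "distr (gamma_law (\<alpha> k) \<Otimes>\<^sub>M gamma_law (\<Sum>j\<in>J. \<alpha> j)) borel (\<lambda>(x, y). x + y)
      = gamma_law (\<Sum>j\<in>insert k J. \<alpha> j)"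
    using insert pos by (subst gamma_law_add) auto
  finally show ?case .
qed

text \<open>
  Both distribution functions are compared at \<open>y = r\<^sup>2\<close>. Substituting \<open>x = z\<^sup>2\<close> in the gamma integral gives
  twice the Gaussian integral over \<open>{0..r}\<close>, hence the one over \<open>{-r..r}\<close> by symmetry.
\<close>
lemma std_normal_square:
  "distr (density lborel std_normal_density) borel (\<lambda>z. z\<^sup>2) = gamma_law (1/2)"
proof (rule cdf_unique)
  let ?N = "density lborel std_normal_density"
  interpret N: prob_space ?N by (rule prob_space_normal_density) simp
  interpret G: prob_space "gamma_law (1/2)" by (rule prob_space_gamma_law) simp
  show "real_distribution (distr ?N borel (\<lambda>z. z\<^sup>2))"
    by (rule N.real_distribution_distr) simp
  show "real_distribution (gamma_law (1/2))"
    by unfold_locales simp_all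
  have "emeasure (distr ?N borel (\<lambda>z. z\<^sup>2)) {..y} = emeasure (gamma_law (1/2)) {..y}" for y
  proof (cases "y \<ge> 0")
    case False
    then have "(\<lambda>z. z\<^sup>2) -` {..y} = {}" by (auto simp: not_le) (smt (verit) zero_le_power2)
    moreover have "gamma_dens (1/2) x = 0 \<or> indicator {..y} x = (0::ennreal)" for x
      using False by (auto simp: gamma_dens_def indicator_def)
    then have "emeasure (gamma_law (1/2)) {..y} = (\<integral>\<^sup>+x. 0 \<partial>(lborel :: real measure))"
      unfolding gamma_law_def
      by (subst emeasure_density) (auto intro!: nn_integral_cong simp del: nn_integral_const)
    ultimately show ?thesis by (simp add: emeasure_distr)
  next
    case True
    define r where "r = sqrt y"
    have r: "r \<ge> 0" "y = r\<^sup>2" using True by (simp_all add: r_def)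
    have phi: "gamma_dens (1/2) (z\<^sup>2) * (2 * z) = 2 * std_normal_density z" if "z > 0" for z
      using that by (simp add: gamma_dens_def std_normal_density_def Gamma_one_half_real powr_minus
          powr_half_sqrt real_sqrt_mult field_simps)
    have "emeasure (gamma_law (1/2)) {..y} = (\<integral>\<^sup>+x. ennreal (gamma_dens (1/2) x) * indicator {..y} x \<partial>lborel)"
      unfolding gamma_law_def by (rule emeasure_density) auto
    also have "\<dots> = (\<integral>\<^sup>+x. ennreal (gamma_dens (1/2) x * indicator {0\<^sup>2..r\<^sup>2} x) \<partial>lborel)"
      unfolding r by (intro nn_integral_cong) (auto simp: gamma_dens_def indicator_def)
    also have "\<dots> = (\<integral>\<^sup>+z. ennreal (gamma_dens (1/2) (z\<^sup>2) * (2 * z) * indicator {0..r} z) \<partial>lborel)"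
      by (rule nn_integral_substitution)
         (use r in \<open>auto intro!: derivative_eq_intros continuous_intros simp: set_borel_measurable_def\<close>)
    also have "\<dots> = (\<integral>\<^sup>+z. 2 * (ennreal (std_normal_density z) * indicator {0..r} z) \<partial>lborel)"
    proof (rule nn_integral_cong_AE, use AE_lborel_singleton[of "0::real"] in eventually_elim)
      case (elim z)
      then have "gamma_dens (1/2) (z\<^sup>2) * (2 * z) * indicator {0..r} z = 2 * std_normal_density z * indicator {0..r} z"
        using phi[of z] by (cases "z > 0") simp_all
      then show ?case by (simp only:) (simp add: indicator_def ennreal_mult')
    qed
    also have "\<dots> = (\<integral>\<^sup>+z. ennreal (std_normal_density z) * indicator {0..r} z \<partial>lborel)
       + (\<integral>\<^sup>+z. ennreal (std_normal_density z) * indicator {0..r} z \<partial>lborel)"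
      by (subst nn_integral_cmult) (auto simp: mult_2)
    also have "\<dots> = (\<integral>\<^sup>+z. ennreal (std_normal_density z) * indicator {0..r} z \<partial>lborel)
       + (\<integral>\<^sup>+z. ennreal (std_normal_density z) * indicator {-r..0} z \<partial>lborel)"
      by (subst (2) nn_integral_real_affine[where c = "-1" and t = 0])
         (auto simp: std_normal_density_def indicator_def intro!: arg_cong2[where f = "(+)"] nn_integral_cong)
    also have "\<dots> = (\<integral>\<^sup>+z. ennreal (std_normal_density z) * indicator {0..r} z
       + ennreal (std_normal_density z) * indicator {-r..0} z \<partial>lborel)"
      by (rule nn_integral_add[symmetric]) auto
    also have "\<dots> = (\<integral>\<^sup>+z. ennreal (std_normal_density z) * indicator {-r..r} z \<partial>lborel)"
      by (rule nn_integral_cong_AE, use AE_lborel_singleton[of "0::real"] in eventually_elim)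
         (use r in \<open>auto simp: indicator_def\<close>)
    also have "\<dots> = emeasure ?N {-r..r}"
      by (rule emeasure_density[symmetric]) auto
    also have "{-r..r} = (\<lambda>z. z\<^sup>2) -` {..y}"
      using r by (auto simp: abs_le_square_iff[symmetric])
    finally show ?thesis by (simp add: emeasure_distr)
  qed
  then show "cdf (distr ?N borel (\<lambda>z. z\<^sup>2)) = cdf (gamma_law (1/2))"
    by (auto simp: cdf_def measure_def)
qed

lemma chi_square_eq_gamma_law:
  assumes "k \<ge> 1"
  shows "chi_square_distribution k = gamma_law (real k / 2)"
proof -
  let ?N = "density lborel (\<lambda>x. ennreal (std_normal_density x))"
  have N: "prob_space ?N" by (rule prob_space_normal_density) simp
  have sq: "compose {1..k} (\<lambda>z. z\<^sup>2) \<in> (\<Pi>\<^sub>M i\<in>{1..k}. ?N) \<rightarrow>\<^sub>M (\<Pi>\<^sub>M i\<in>{1..k}. borel)"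
    unfolding compose_def by measurable
  have "chi_square_distribution k
     = distr (distr (\<Pi>\<^sub>M i\<in>{1..k}. ?N) (\<Pi>\<^sub>M i\<in>{1..k}. borel) (compose {1..k} (\<lambda>z. z\<^sup>2))) borel (\<lambda>x. \<Sum>i=1..k. x i)"
    unfolding chi_square_distribution_def
    by (subst distr_distr[OF _ sq]) (auto simp: comp_def compose_def intro!: distr_cong)
  also have "distr (\<Pi>\<^sub>M i\<in>{1..k}. ?N) (\<Pi>\<^sub>M i\<in>{1..k}. borel) (compose {1..k} (\<lambda>z. z\<^sup>2))
     = distr (\<Pi>\<^sub>M i\<in>{1..k}. ?N) (\<Pi>\<^sub>M i\<in>{1..k}. gamma_law (1/2)) (compose {1..k} (\<lambda>z. z\<^sup>2))"
    by (intro distr_cong sets_PiM_cong) auto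
  also have "\<dots> = (\<Pi>\<^sub>M i\<in>{1..k}. distr ?N (gamma_law (1/2)) (\<lambda>z. z\<^sup>2))"
    by (rule distr_PiM_finite_prob_space') (auto intro: N prob_space_gamma_law)
  also have "distr ?N (gamma_law (1/2)) (\<lambda>z. z\<^sup>2) = gamma_law (1/2)"
    unfolding std_normal_square[symmetric] by (rule distr_cong) auto
  also have "distr (\<Pi>\<^sub>M i\<in>{1..k}. gamma_law (1/2)) borel (\<lambda>x. \<Sum>i=1..k. x i) = gamma_law (real k / 2)"
    using assms by (subst gamma_law_sum) auto
  finally show ?thesis .
qed

lemma chi_square_ratio_eq_scaled_F:
  assumes "m \<ge> 1"
  shows "chi_square_ratio_distribution m 1 = distr (F_distribution m 1) borel (\<lambda>x. real m * x)"
proof -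
  have [measurable_cong]: "sets (chi_square_distribution k) = sets borel" for k
    by (simp add: chi_square_distribution_def)
  show ?thesis
    unfolding chi_square_ratio_distribution_def F_distribution_def using assms
    by (subst distr_distr) (auto simp: comp_def case_prod_beta' intro!: distr_cong)
qed

section \<open>An identity for the arcsine law\<close>

lemma arctan_diff:
  assumes "0 \<le> s" "s \<le> t"
  shows "arctan t - arctan s = arctan ((t - s) / (1 + s * t))"
proof -
  have bounds: "0 \<le> arctan t - arctan s" "arctan t - arctan s < pi / 2"
    using assms arctan_ubound[of t] arctan_monotone'[of s t]
      zero_le_arctan_iff[of s] by linarith+
  then have cos: "cos (arctan t - arctan s) \<noteq> 0"
    using cos_gt_zero_pi[of "arctan t - arctan s"] by linarith
  have "tan (arctan t - arctan s) = (t - s) / (1 + t * s)"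
    using tan_diff[OF cos_arctan_not_zero cos_arctan_not_zero cos] by (simp add: tan_arctan)
  then have "arctan ((t - s) / (1 + t * s)) = arctan t - arctan s"
    using bounds by (intro arctan_unique) auto
  then show ?thesis by (simp add: mult.commute)
qed

text \<open>
  If \<open>U = 1 / (1 + T\<^sup>2)\<close> with \<open>T > 0\<close> has the arcsine law, then \<open>T\<close> is half-Cauchy: its distribution function is
  \<open>2 / pi * arctan\<close>. For \<open>s = 0\<close> the interval reaches the singularity of the density at \<open>1\<close>, whence the
  fundamental theorem of calculus for open intervals in the proof.
\<close>
lemma emeasure_arcsine:
  assumes "0 \<le> s" "s \<le> t"
  shows "emeasure (beta_distribution (1/2) (1/2)) {1 / (1 + t\<^sup>2) .. 1 / (1 + s\<^sup>2)}
    = ennreal (2 / pi * (arctan t - arctan s))"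
proof (cases "s = t")
  case True
  then have "emeasure (beta_distribution (1/2) (1/2)) {1 / (1 + t\<^sup>2) .. 1 / (1 + s\<^sup>2)}
    = (\<integral>\<^sup>+x. 0 \<partial>(lborel :: real measure))"
    unfolding beta_distribution_eq
    by (subst emeasure_density)
      (auto intro!: nn_integral_cong_AE AE_mp[OF AE_lborel_singleton[of "1 / (1 + t\<^sup>2)"]])
  then show ?thesis using True by simp
next
  case False
  define l where "l = 1 / (1 + t\<^sup>2)"
  define u where "u = 1 / (1 + s\<^sup>2)"
  define F :: "real \<Rightarrow> real" where "F = (\<lambda>x. - (2 / pi) * arctan (sqrt ((1 - x) / x)))"
  have l0: "0 < l" and u1: "u \<le> 1"
    by (simp_all add: l_def u_def add_pos_nonneg)
  have "s\<^sup>2 < t\<^sup>2" using assms False by (intro power_strict_mono) auto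
  then have lu: "l < u" by (simp add: l_def u_def divide_strict_left_mono add_pos_nonneg)
  have F_t: "F l = - (2 / pi) * arctan t" and F_s: "F u = - (2 / pi) * arctan s"
    using assms by (simp_all add: F_def l_def u_def divide_simps add_pos_nonneg add_nonneg_eq_0_iff)
  have DF: "(F has_real_derivative beta_dens (1/2) (1/2) x) (at x)" if "0 < x" "x < 1" for x
  proof -
    have 1: "1 + (sqrt ((1 - x) / x))\<^sup>2 = 1 / x" using that by (simp add: field_simps)
    have 2: "beta_dens (1/2) (1/2) x = 1 / (pi * (sqrt x * sqrt (1 - x)))"
      using that by (simp add: beta_dens_def Beta_def Gamma_one_half_real powr_minus powr_half_sqrt field_simps)
    have "(F has_real_derivative
       - (2 / pi) * (inverse (1 + (sqrt ((1 - x) / x))\<^sup>2) *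
          (inverse (sqrt ((1 - x) / x)) / 2 * ((- 1 * x - (1 - x) * 1) / (x * x))))) (at x)"
      unfolding F_def using that
      by (auto intro!: derivative_eq_intros simp: field_simps)
    also have "- (2 / pi) * (inverse (1 + (sqrt ((1 - x) / x))\<^sup>2) *
          (inverse (sqrt ((1 - x) / x)) / 2 * ((- 1 * x - (1 - x) * 1) / (x * x))))
        = beta_dens (1/2) (1/2) x"
    proof -
      have "- (2 / pi) * (inverse (1 / (p * p)) * (inverse (q / p) / 2 * (- 1 / ((p * p) * (p * p)))))
          = 1 / (pi * (p * q))" if "p > 0" "q > 0" for p q :: real
        using that by (simp add: field_simps)
      from this[of "sqrt x" "sqrt (1 - x)"] show ?thesis
        unfolding 1 2 using that by (simp add: real_sqrt_divide)
    qed
    finally show ?thesis .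
  qed
  have contF: "isCont F x" if "0 < x" for x
    unfolding F_def using that by (intro continuous_intros) auto
  have "continuous_on {0<..<1} (\<lambda>x. x powr (1/2 - 1) * (1 - x) powr (1/2 - 1) / Beta (1/2) (1/2 :: real))"
    using Beta_real_pos[of "1/2" "1/2"] by (intro continuous_intros) auto
  then have "continuous_on {0<..<1} (beta_dens (1/2) (1/2))"
    by (rule continuous_on_eq) (simp add: beta_dens_def)
  then have cont: "isCont (beta_dens (1/2) (1/2)) x" if "0 < x" "x < 1" for x
    using that by (simp add: continuous_on_eq_continuous_at)
  \<comment> \<open>\<open>F\<close> is continuous at \<open>u\<close> even when \<open>u = 1\<close>, where it is not differentiable.\<close>
  have lims: "((F \<circ> real_of_ereal) \<longlongrightarrow> F l) (at_right (ereal l))"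
    "((F \<circ> real_of_ereal) \<longlongrightarrow> F u) (at_left (ereal u))"
    using contF[of l] contF[of u] l0 lu
    by (auto simp: ereal_tendsto_simps isCont_def filterlim_at_split)
  have inside: "0 < x" "x < 1" if "ereal l < ereal x" "ereal x < ereal u" for x
    using that l0 u1 by simp_all
  have FTC: "set_integrable lborel (einterval (ereal l) (ereal u)) (beta_dens (1/2) (1/2))
     \<and> (LBINT x=ereal l..ereal u. beta_dens (1/2) (1/2) x) = F u - F l"
  proof (intro conjI interval_integral_FTC_nonneg[OF _ _ _ _ lims])
    fix x assume x: "ereal l < ereal x" "ereal x < ereal u"
    show "(F has_real_derivative beta_dens (1/2) (1/2) x) (at x)"
      and "(F has_real_derivative beta_dens (1/2) (1/2) x) (at x)"
      by (rule DF[OF inside[OF x]])+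
    show "isCont (beta_dens (1/2) (1/2)) x" and "isCont (beta_dens (1/2) (1/2)) x"
      by (rule cont[OF inside[OF x]])+
  qed (use lu in auto)
  have "emeasure (beta_distribution (1/2) (1/2)) {l .. u}
      = (\<integral>\<^sup>+x. ennreal (beta_dens (1/2) (1/2) x) * indicator {l..u} x \<partial>lborel)"
    unfolding beta_distribution_eq by (rule emeasure_density) auto
  also have "\<dots> = (\<integral>\<^sup>+x. ennreal (indicator {l<..<u} x *\<^sub>R beta_dens (1/2) (1/2) x) \<partial>lborel)"
    by (rule nn_integral_cong_AE, use AE_lborel_singleton[of l] AE_lborel_singleton[of u] in eventually_elim)
       (auto simp: indicator_def)
  also have "\<dots> = ennreal (LINT x:{l<..<u}|lborel. beta_dens (1/2) (1/2) x)"
    unfolding set_lebesgue_integral_def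
    using FTC by (intro nn_integral_eq_integral) (auto simp: set_integrable_def)
  also have "(LINT x:{l<..<u}|lborel. beta_dens (1/2) (1/2) x) = F u - F l"
    using FTC lu by (simp add: interval_lebesgue_integral_def)
  also have "F u - F l = 2 / pi * (arctan t - arctan s)"
    by (simp add: F_t F_s field_simps)
  finally show ?thesis unfolding l_def u_def .
qed

lemma sqrt_odds:
  assumes "0 < x" "x < (1::real)"
  obtains t where "t > 0" "x = 1 / (1 + t\<^sup>2)"
proof
  show "sqrt ((1 - x) / x) > 0" using assms by simp
  show "x = 1 / (1 + (sqrt ((1 - x) / x))\<^sup>2)"
    using assms by (simp add: field_simps)
qed

lemma odds_interval:
  assumes "0 \<le> s" "0 \<le> (t::real)" "0 < r"
  shows "1 / (1 + r\<^sup>2) \<in> {1 / (1 + t\<^sup>2) .. 1 / (1 + s\<^sup>2)} \<longleftrightarrow> s \<le> r \<and> r \<le> t"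
proof -
  have "1 / (1 + r\<^sup>2) \<le> 1 / (1 + s\<^sup>2) \<longleftrightarrow> s\<^sup>2 \<le> r\<^sup>2" "1 / (1 + t\<^sup>2) \<le> 1 / (1 + r\<^sup>2) \<longleftrightarrow> r\<^sup>2 \<le> t\<^sup>2"
    by (simp_all add: divide_simps add_pos_nonneg add_nonneg_eq_0_iff)
  then show ?thesis using assms by (auto simp: abs_le_square_iff[symmetric])
qed

text \<open>
  Boole's transformation \<open>t \<mapsto> a t - b / t\<close> is increasing on the positive reals, and the preimages of \<open>-y\<close>
  and \<open>y\<close> are the positive roots of \<open>a t\<^sup>2 + y t - b\<close> and \<open>a t\<^sup>2 - y t - b\<close>.
\<close>
lemma boole_preimage:
  assumes "a > 0" "b > 0" "y \<ge> 0" "t > (0::real)"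
  defines "r \<equiv> sqrt (y\<^sup>2 + 4 * a * b)"
  shows "(a * t - b / t)\<^sup>2 \<le> y\<^sup>2 \<longleftrightarrow> (r - y) / (2 * a) \<le> t \<and> t \<le> (r + y) / (2 * a)"
proof -
  have r2: "r\<^sup>2 = y\<^sup>2 + 4 * a * b" using assms by (simp add: r_def)
  have r: "y < r" unfolding r_def using assms by (intro real_less_rsqrt) simp
  have eq1: "4 * a * (a * t\<^sup>2 - y * t - b) = (2 * a * t - (r + y)) * (2 * a * t + (r - y))"
    and eq2: "4 * a * (a * t\<^sup>2 + y * t - b) = (2 * a * t + (r + y)) * (2 * a * t - (r - y))"
    using r2 by (simp_all add: algebra_simps power2_eq_square)
  have "(a * t - b / t)\<^sup>2 \<le> y\<^sup>2 \<longleftrightarrow> \<bar>a * t - b / t\<bar> \<le> y"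
    using assms by (metis abs_le_square_iff abs_of_nonneg)
  also have "\<dots> \<longleftrightarrow> a * t\<^sup>2 - y * t - b \<le> 0 \<and> 0 \<le> a * t\<^sup>2 + y * t - b"
    using assms by (auto simp: abs_le_iff field_simps power2_eq_square)
  also have "\<dots> \<longleftrightarrow> 4 * a * (a * t\<^sup>2 - y * t - b) \<le> 0 \<and> 0 \<le> 4 * a * (a * t\<^sup>2 + y * t - b)"
    using assms by (simp add: mult_le_0_iff zero_le_mult_iff)
  also have "\<dots> \<longleftrightarrow> 2 * a * t - (r + y) \<le> 0 \<and> 0 \<le> 2 * a * t - (r - y)"
  proof -
    have "0 < 2 * a * t + (r - y)" "0 < 2 * a * t + (r + y)"
      using r assms by (simp_all add: add_pos_pos)
    then show ?thesis unfolding eq1 eq2 by (auto simp: mult_le_0_iff zero_le_mult_iff)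
  qed
  also have "\<dots> \<longleftrightarrow> (r - y) / (2 * a) \<le> t \<and> t \<le> (r + y) / (2 * a)"
    using assms by (auto simp: field_simps)
  finally show ?thesis .
qed

text \<open>
  In terms of \<open>T\<close> with \<open>U = 1 / (1 + T\<^sup>2)\<close>, the two variables are \<open>(a T - b / T)\<^sup>2\<close> and \<open>((a + b) T)\<^sup>2\<close>, up
  to the common summand \<open>(a + b)\<^sup>2\<close>. The first is at most \<open>y\<^sup>2\<close> on an interval from \<open>s\<close> to \<open>t\<close> with
  \<open>t - s = y / a\<close> and \<open>s * t = b / a\<close>, and \<open>arctan t - arctan s\<close> equals
  \<open>arctan (y / (a + b))\<close>, the value that belongs to the second. If a weight vanishes there is no
  interval to compute, but then the claim is trivial or follows from the symmetry of the arcsine law.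
\<close>
lemma arcsine_inverse_sum:
  assumes "a \<ge> 0" "b \<ge> 0"
  shows "distr (beta_distribution (1/2) (1/2)) borel (\<lambda>x. a\<^sup>2 / x + b\<^sup>2 / (1 - x))
    = distr (beta_distribution (1/2) (1/2)) borel (\<lambda>x. (a + b)\<^sup>2 / x)"
proof -
  let ?B = "beta_distribution (1/2) (1/2)"
  interpret B: prob_space ?B by (rule prob_space_beta_distribution) auto
  have AE: "AE x in ?B. 0 < x \<and> x < 1" by (rule AE_beta_distribution) auto
  consider "b = 0" | "a = 0" | "a > 0" "b > 0" using assms by force
  then show ?thesis
  proof cases
    case 1
    then show ?thesis by simp
  next
    case 2
    have "distr ?B borel (\<lambda>x. b\<^sup>2 / (1 - x)) = distr (distr ?B borel (\<lambda>x. 1 - x)) borel (\<lambda>x. b\<^sup>2 / x)"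
      by (subst distr_distr) (auto simp: comp_def)
    then show ?thesis using 2 by (simp add: beta_distribution_reflect)
  next
    case 3
    let ?V = "\<lambda>x::real. a\<^sup>2 / x + b\<^sup>2 / (1 - x)" and ?U = "\<lambda>x::real. (a + b)\<^sup>2 / x"
    have V: "?V (1 / (1 + t\<^sup>2)) = (a * t - b / t)\<^sup>2 + (a + b)\<^sup>2"
      and U: "?U (1 / (1 + t\<^sup>2)) = ((a + b) * t)\<^sup>2 + (a + b)\<^sup>2" if "t > 0" for t
    proof -
      have "1 + t\<^sup>2 \<noteq> 0" by (simp add: add_nonneg_eq_0_iff)
      then have "1 - 1 / (1 + t\<^sup>2) = t\<^sup>2 / (1 + t\<^sup>2)" by (simp add: field_simps)
      then have "?V (1 / (1 + t\<^sup>2)) = a\<^sup>2 * (1 + t\<^sup>2) + b\<^sup>2 * (1 + t\<^sup>2) / t\<^sup>2" by simp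
      also have "\<dots> = (a * t - b / t)\<^sup>2 + (a + b)\<^sup>2"
        using that by (simp add: field_simps power2_eq_square)
      finally show "?V (1 / (1 + t\<^sup>2)) = (a * t - b / t)\<^sup>2 + (a + b)\<^sup>2" .
      show "?U (1 / (1 + t\<^sup>2)) = ((a + b) * t)\<^sup>2 + (a + b)\<^sup>2"
        by (simp add: field_simps power2_eq_square)
    qed
    have cdf_V: "emeasure ?B {x. ?V x \<le> z} = emeasure ?B {x. ?U x \<le> z}" for z
    proof (cases "(a + b)\<^sup>2 \<le> z")
      case False
      have "AE x in ?B. \<not> ?V x \<le> z \<and> \<not> ?U x \<le> z"
        using AE
      proof eventually_elim
        case (elim x)
        then obtain t where t: "t > 0" "x = 1 / (1 + t\<^sup>2)" using sqrt_odds[of x] by metis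
        show ?case using False
          unfolding t(2) V[OF t(1)] U[OF t(1)] by (smt (verit) zero_le_power2)
      qed
      then show ?thesis
        by (intro emeasure_eq_AE) (auto elim: eventually_mono)
    next
      case True
      define y where "y = sqrt (z - (a + b)\<^sup>2)"
      have y: "y \<ge> 0" "z = y\<^sup>2 + (a + b)\<^sup>2" using True by (simp_all add: y_def)
      define r where "r = sqrt (y\<^sup>2 + 4 * a * b)"
      have r2: "r\<^sup>2 = y\<^sup>2 + 4 * a * b" using 3 by (simp add: r_def)
      have r: "y < r" unfolding r_def using 3 by (intro real_less_rsqrt) simp
      let ?s = "(r - y) / (2 * a)" and ?t = "(r + y) / (2 * a)" and ?m = "y / (a + b)"
      have st: "0 \<le> ?s" "?s \<le> ?t" "0 \<le> ?t" and m: "0 \<le> ?m"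
        using 3 r y by (auto simp: divide_right_mono)
      have "emeasure ?B {x. ?V x \<le> z} = emeasure ?B {1 / (1 + ?t\<^sup>2) .. 1 / (1 + ?s\<^sup>2)}"
      proof (rule emeasure_eq_AE)
        show "AE x in ?B. (x \<in> {x. ?V x \<le> z}) = (x \<in> {1 / (1 + ?t\<^sup>2) .. 1 / (1 + ?s\<^sup>2)})"
          using AE
        proof eventually_elim
          case (elim x)
          then obtain t where t: "t > 0" "x = 1 / (1 + t\<^sup>2)" using sqrt_odds[of x] by metis
          show ?case
            unfolding t(2) mem_Collect_eq V[OF t(1)] odds_interval[OF st(1) st(3) t(1)] y(2)
            using boole_preimage[OF 3 y(1) t(1)] by (simp add: r_def)
        qed
      qed auto
      also have "\<dots> = ennreal (2 / pi * (arctan ?t - arctan ?s))"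
        by (rule emeasure_arcsine[OF st(1,2)])
      also have "arctan ?t - arctan ?s = arctan ?m - arctan 0"
      proof -
        have "(r - y) * (r + y) = 4 * a * b"
          using r2 by (simp add: algebra_simps power2_eq_square)
        then have "?s * ?t = b / a"
          using 3 by (simp add: field_simps)
        moreover have "?t - ?s = y / a" using 3 by (simp add: field_simps)
        ultimately have "arctan ?t - arctan ?s = arctan (y / a / (1 + b / a))"
          using arctan_diff[OF st(1,2)] by simp
        also have "y / a / (1 + b / a) = ?m" using 3 by (simp add: field_simps)
        finally show ?thesis by simp
      qed
      also have "ennreal (2 / pi * (arctan ?m - arctan 0)) = emeasure ?B {1 / (1 + ?m\<^sup>2) .. 1 / (1 + 0\<^sup>2)}"
        by (rule emeasure_arcsine[symmetric]) (use m in auto)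
      also have "\<dots> = emeasure ?B {x. ?U x \<le> z}"
      proof (rule emeasure_eq_AE)
        show "AE x in ?B. (x \<in> {1 / (1 + ?m\<^sup>2) .. 1 / (1 + 0\<^sup>2)}) = (x \<in> {x. ?U x \<le> z})"
          using AE
        proof eventually_elim
          case (elim x)
          then obtain t where t: "t > 0" "x = 1 / (1 + t\<^sup>2)" using sqrt_odds[of x] by metis
          have "((a + b) * t)\<^sup>2 \<le> y\<^sup>2 \<longleftrightarrow> t \<le> ?m"
            using 3 t y by (subst abs_le_square_iff[symmetric]) (simp add: field_simps abs_mult)
          then show ?case
            unfolding t(2) mem_Collect_eq U[OF t(1)] odds_interval[OF order_refl m t(1)] y(2)
            using t(1) by simp
        qed
      qed auto
      finally show ?thesis .
    qed
    have cdf: "cdf (distr ?B borel f) z = measure ?B {x. f x \<le> z}" if "f \<in> borel_measurable borel" for f z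
      using that unfolding cdf_def by (subst measure_distr) (auto simp: vimage_def)
    show ?thesis
    proof (rule cdf_unique)
      show "real_distribution (distr ?B borel ?V)" "real_distribution (distr ?B borel ?U)"
        by (auto intro!: B.real_distribution_distr)
      show "cdf (distr ?B borel ?V) = cdf (distr ?B borel ?U)"
        by (rule ext) (simp add: cdf measure_def cdf_V)
    qed
  qed
qed

section \<open>Sums of independent reciprocal pairs\<close>

text \<open>
  With \<open>x\<close> the square of a standard normal variable, \<open>a\<^sup>2 / x\<close> has the one-sided 1/2-stable law of Levy, and
  squaring \<open>a\<close> makes these scales add up under convolution.
\<close>
definition reciprocal_pair :: "real \<Rightarrow> (real \<times> real) measure" where
  "reciprocal_pair a = distr (gamma_law (1/2)) borel (\<lambda>x. (x, a\<^sup>2 / x))"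

lemma sets_reciprocal_pair [simp, measurable_cong]: "sets (reciprocal_pair a) = sets borel"
  by (simp add: reciprocal_pair_def)

lemma prob_space_reciprocal_pair: "prob_space (reciprocal_pair a)"
  unfolding reciprocal_pair_def by (intro prob_space.prob_space_distr prob_space_gamma_law) auto

text \<open>
  In the coordinates total \<open>r\<close> and proportion \<open>u\<close>, the second component
  \<open>a\<^sup>2 / x + b\<^sup>2 / y\<close> is \<open>(a\<^sup>2 / u + b\<^sup>2 / (1 - u)) / r\<close>. So the weights enter only through the law of a function
  of \<open>u\<close>, which is independent of \<open>r\<close>.
\<close>
lemma reciprocal_pair_convolution_polar:
  "(reciprocal_pair a \<star> reciprocal_pair b) = distr (gamma_law 1 \<Otimes>\<^sub>M
      distr (beta_distribution (1/2) (1/2)) borel (\<lambda>x. a\<^sup>2 / x + b\<^sup>2 / (1 - x)))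
    borel (\<lambda>(r, v). (r, v / r))"
proof -
  let ?G = "gamma_law (1/2)" and ?B = "beta_distribution (1/2) (1/2)"
  let ?h = "\<lambda>x::real. a\<^sup>2 / x + b\<^sup>2 / (1 - x)"
  interpret B: prob_space ?B by (rule prob_space_beta_distribution) auto
  have sf: "sigma_finite_measure (reciprocal_pair b)"
    by (rule prob_space_imp_sigma_finite[OF prob_space_reciprocal_pair])
  have hB: "sigma_finite_measure (distr ?B borel ?h)"
    by (rule prob_space_imp_sigma_finite[OF B.prob_space_distr]) measurable
  have "(reciprocal_pair a \<star> reciprocal_pair b) = distr (?G \<Otimes>\<^sub>M ?G) borel (\<lambda>(x, y). (x + y, a\<^sup>2 / x + b\<^sup>2 / y))"
    using sf unfolding convolution_def reciprocal_pair_def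
    by (subst pair_measure_distr) (auto simp: distr_distr comp_def case_prod_beta')
  also have "\<dots> = distr (?G \<Otimes>\<^sub>M ?G) borel
      (\<lambda>(x, y). (x + y, ?h (x / (x + y)) / (x + y)))"
  proof (rule distr_cong_AE)
    show "AE z in ?G \<Otimes>\<^sub>M ?G. (case z of (x, y) \<Rightarrow> (x + y, a\<^sup>2 / x + b\<^sup>2 / y)) =
        (case z of (x, y) \<Rightarrow> (x + y, ?h (x / (x + y)) / (x + y)))"
      using AE_gamma_law_pair_pos[OF half_gt_zero[OF zero_less_one] half_gt_zero[OF zero_less_one]]
    proof eventually_elim
      case (elim z)
      then have "1 - fst z / (fst z + snd z) = snd z / (fst z + snd z)"
        by (simp add: field_simps)
      then show ?case using elim by (simp add: case_prod_beta add_divide_distrib)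
    qed
  qed simp_all
  also have "\<dots> = distr (distr (?G \<Otimes>\<^sub>M ?G) (borel \<Otimes>\<^sub>M borel) (\<lambda>(x, y). (x + y, x / (x + y)))) borel
      (\<lambda>(r, u). (r, ?h u / r))"
    by (subst distr_distr) (auto simp: comp_def case_prod_beta')
  also have "\<dots> = distr (gamma_law 1 \<Otimes>\<^sub>M ?B) borel (\<lambda>(r, u). (r, ?h u / r))"
    by (subst gamma_beta_independent) auto
  also have "\<dots> = distr (distr (gamma_law 1 \<Otimes>\<^sub>M ?B) (borel \<Otimes>\<^sub>M borel) (\<lambda>(r, u). (r, ?h u)))
      borel (\<lambda>(r, v). (r, v / r))"
    by (subst distr_distr) (auto simp: comp_def case_prod_beta')
  also have "distr (gamma_law 1 \<Otimes>\<^sub>M ?B) (borel \<Otimes>\<^sub>M borel) (\<lambda>(r, u). (r, ?h u))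
      = distr (gamma_law 1) borel (\<lambda>x. x) \<Otimes>\<^sub>M distr ?B borel ?h"
    by (subst pair_measure_distr[OF _ _ hB]) auto
  also have "distr (gamma_law 1) borel (\<lambda>x. x) = gamma_law 1"
    by (rule distr_id2) simp
  finally show ?thesis .
qed

lemma reciprocal_pair_convolution:
  assumes "a \<ge> 0" "b \<ge> 0"
  shows "(reciprocal_pair a \<star> reciprocal_pair b) = (reciprocal_pair (a + b) \<star> reciprocal_pair 0)"
  unfolding reciprocal_pair_convolution_polar arcsine_inverse_sum[OF assms] by simp

definition weighted_sums_law :: "'i set \<Rightarrow> ('i \<Rightarrow> real) \<Rightarrow> (real \<times> real) measure" where
  "weighted_sums_law J w =
    distr (\<Pi>\<^sub>M j\<in>J. gamma_law (1/2)) borel (\<lambda>x. (\<Sum>j\<in>J. x j, \<Sum>j\<in>J. (w j)\<^sup>2 / x j))"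

lemma sets_weighted_sums_law [simp, measurable_cong]: "sets (weighted_sums_law J w) = sets borel"
  by (simp add: weighted_sums_law_def)

lemma prob_space_weighted_sums_law: "prob_space (weighted_sums_law J w)"
  unfolding weighted_sums_law_def
  by (intro prob_space.prob_space_distr prob_space_gamma_PiM) auto

lemma weighted_sums_law_insert:
  assumes "finite J" "k \<notin> J"
  shows "weighted_sums_law (insert k J) w = (reciprocal_pair (w k) \<star> weighted_sums_law J w)"
proof -
  let ?G = "gamma_law (1/2)" and ?P = "\<Pi>\<^sub>M j\<in>J. gamma_law (1/2)"
  have sum_upd: "(\<Sum>j\<in>J. f j ((X(k := x)) j)) = (\<Sum>j\<in>J. f j (X j))"
    for f :: "'a \<Rightarrow> real \<Rightarrow> real" and X x
    using assms by (intro sum.cong) auto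
  have "weighted_sums_law (insert k J) w = distr (?G \<Otimes>\<^sub>M ?P) borel
     (\<lambda>(x, X). (\<Sum>j\<in>insert k J. (X(k := x)) j, \<Sum>j\<in>insert k J. (w j)\<^sup>2 / (X(k := x)) j))"
    unfolding weighted_sums_law_def
    by (subst distr_PiM_insert) (auto intro: prob_space_gamma_law)
  also have "\<dots> = distr (?G \<Otimes>\<^sub>M ?P) borel
     (\<lambda>(x, X). (x, (w k)\<^sup>2 / x) + (\<Sum>j\<in>J. X j, \<Sum>j\<in>J. (w j)\<^sup>2 / X j))"
    using assms sum_upd[of "\<lambda>j x. x"] sum_upd[of "\<lambda>j x. (w j)\<^sup>2 / x"]
    by (simp add: case_prod_beta)
  also have "\<dots> = (reciprocal_pair (w k) \<star> weighted_sums_law J w)"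
    using prob_space_imp_sigma_finite[OF prob_space_weighted_sums_law[of J w]]
    unfolding convolution_def reciprocal_pair_def weighted_sums_law_def
    by (subst pair_measure_distr) (auto simp: distr_distr comp_def case_prod_beta')
  finally show ?thesis .
qed

text \<open>
  The extra pair of scale \<open>a\<close> collects the weights of \<open>J\<close> one after another; each of them leaves a pair of
  scale \<open>0\<close> behind.
\<close>
lemma weighted_sums_law_concentrate:
  assumes "finite J" "\<And>j. j \<in> J \<Longrightarrow> w j \<ge> 0" "a \<ge> 0"
  shows "(reciprocal_pair a \<star> weighted_sums_law J w) = (reciprocal_pair (a + (\<Sum>j\<in>J. w j)) \<star> weighted_sums_law J (\<lambda>_. 0))"
  using assms
proof (induction J arbitrary: a rule: finite_induct)
  case empty
  then show ?case by (simp add: weighted_sums_law_def)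
next
  case (insert k J)
  note fin = prob_space.finite_measure[OF prob_space_reciprocal_pair]
    prob_space.finite_measure[OF prob_space_weighted_sums_law]
  let ?LW = "weighted_sums_law J w" and ?LZ = "weighted_sums_law J (\<lambda>_. 0)"
  have wk: "w k \<ge> 0" using insert by auto
  have "(reciprocal_pair a \<star> weighted_sums_law (insert k J) w) = ((reciprocal_pair a \<star> reciprocal_pair (w k)) \<star> ?LW)"
    unfolding weighted_sums_law_insert[OF insert.hyps]
    by (rule convolution_associative) (simp_all add: fin)
  also have "\<dots> = ((reciprocal_pair 0 \<star> reciprocal_pair (a + w k)) \<star> ?LW)"
    unfolding reciprocal_pair_convolution[OF \<open>a \<ge> 0\<close> wk]
    by (subst convolution_commutative) (simp_all add: fin)
  also have "\<dots> = (reciprocal_pair 0 \<star> (reciprocal_pair (a + w k) \<star> ?LW))"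
    by (rule convolution_associative[symmetric]) (simp_all add: fin)
  also have "\<dots> = (reciprocal_pair 0 \<star> (reciprocal_pair (a + w k + (\<Sum>j\<in>J. w j)) \<star> ?LZ))"
    using insert wk by (subst insert.IH) auto
  also have "\<dots> = ((reciprocal_pair 0 \<star> reciprocal_pair (a + w k + (\<Sum>j\<in>J. w j))) \<star> ?LZ)"
    by (rule convolution_associative) (simp_all add: fin)
  also have "\<dots> = ((reciprocal_pair (a + w k + (\<Sum>j\<in>J. w j)) \<star> reciprocal_pair 0) \<star> ?LZ)"
    by (subst convolution_commutative) (simp_all add: fin)
  also have "\<dots> = (reciprocal_pair (a + w k + (\<Sum>j\<in>J. w j)) \<star> (reciprocal_pair 0 \<star> ?LZ))"
    by (rule convolution_associative[symmetric]) (simp_all add: fin)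
  also have "\<dots> = (reciprocal_pair (a + (\<Sum>j\<in>insert k J. w j)) \<star> weighted_sums_law (insert k J) (\<lambda>_. 0))"
    using insert by (simp add: weighted_sums_law_insert add.assoc)
  finally show ?case .
qed

lemma weighted_sums_law_zero:
  assumes "finite J" "J \<noteq> {}"
  shows "weighted_sums_law J (\<lambda>_. 0) = distr (gamma_law (real (card J) / 2)) borel (\<lambda>x. (x, 0))"
proof -
  have "weighted_sums_law J (\<lambda>_. 0)
     = distr (distr (\<Pi>\<^sub>M j\<in>J. gamma_law (1/2)) borel (\<lambda>x. \<Sum>j\<in>J. x j)) borel (\<lambda>x. (x, 0))"
    unfolding weighted_sums_law_def by (subst distr_distr) (auto simp: comp_def)
  then show ?thesis using assms by (simp add: gamma_law_sum)
qed

text \<open>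
  The weights sum to one, so all of them can be moved to the last index; the others contribute only
  their total to the first component.
\<close>
lemma weighted_sums_law_prob_vector:
  assumes "p \<ge> 2" "prob_vector p w"
  shows "weighted_sums_law {1..p} w
    = distr (gamma_law (1/2) \<Otimes>\<^sub>M gamma_law ((real p - 1) / 2)) borel (\<lambda>(x, y). (x + y, 1 / x))"
proof -
  let ?J = "{1..<p}" and ?G = "gamma_law ((real p - 1) / 2)"
  have p: "{1..p} = insert p ?J" using assms(1) by auto
  have w: "w p \<ge> 0" "\<And>j. j \<in> ?J \<Longrightarrow> w j \<ge> 0" "w p + (\<Sum>j\<in>?J. w j) = 1"
    using assms(2) unfolding prob_vector_def p by auto
  have "prob_space ?G" using assms(1) by (intro prob_space_gamma_law) auto
  then have sf: "sigma_finite_measure (distr ?G borel (\<lambda>x. (x, 0::real)))"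
    by (intro prob_space_imp_sigma_finite prob_space.prob_space_distr) auto
  have "weighted_sums_law {1..p} w = (reciprocal_pair (w p) \<star> weighted_sums_law ?J w)"
    unfolding p by (rule weighted_sums_law_insert) auto
  also have "\<dots> = (reciprocal_pair 1 \<star> weighted_sums_law ?J (\<lambda>_. 0))"
    using weighted_sums_law_concentrate[of ?J w "w p"] w by simp
  also have "weighted_sums_law ?J (\<lambda>_. 0) = distr ?G borel (\<lambda>x. (x, 0))"
    using assms(1) by (subst weighted_sums_law_zero) (auto simp: of_nat_diff)
  also have "(reciprocal_pair 1 \<star> distr ?G borel (\<lambda>x. (x, 0)))
      = distr (gamma_law (1/2) \<Otimes>\<^sub>M ?G) borel (\<lambda>(x, y). (x + y, 1 / x))"
    using sf unfolding convolution_def reciprocal_pair_def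
    by (subst pair_measure_distr) (auto simp: distr_distr comp_def case_prod_beta')
  finally show ?thesis .
qed

section \<open>Dirichlet vectors as normalized gamma variables\<close>

interpretation lborel_PiM: product_sigma_finite "\<lambda>_::nat. lborel :: real measure"
  by standard

lemma gamma_PiM_density:
  fixes J :: "nat set"
  assumes "finite J" "\<And>j. j \<in> J \<Longrightarrow> \<alpha> j > 0"
  shows "(\<Pi>\<^sub>M j\<in>J. gamma_law (\<alpha> j))
    = density (\<Pi>\<^sub>M j\<in>J. lborel) (\<lambda>x. ennreal (\<Prod>j\<in>J. gamma_dens (\<alpha> j) (x j)))"
proof -
  \<comment> \<open>Outside \<open>J\<close> the parameter is reset to \<open>1\<close>, so that every factor is \<open>\<sigma>\<close>-finite.\<close>
  define \<beta> where "\<beta> j = (if j \<in> J then \<alpha> j else 1)" for j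
  have pos: "\<beta> j > 0" for j using assms by (simp add: \<beta>_def)
  interpret G: product_sigma_finite "\<lambda>j. gamma_law (\<beta> j)"
    unfolding product_sigma_finite_def
    by (intro allI prob_space_imp_sigma_finite prob_space_gamma_law pos)
  have "density (\<Pi>\<^sub>M j\<in>J. lborel) (\<lambda>x. ennreal (\<Prod>j\<in>J. gamma_dens (\<beta> j) (x j)))
     = (\<Pi>\<^sub>M j\<in>J. gamma_law (\<beta> j))"
  proof (rule G.PiM_eqI[OF assms(1)])
    show "sets (density (\<Pi>\<^sub>M j\<in>J. lborel) (\<lambda>x. ennreal (\<Prod>j\<in>J. gamma_dens (\<beta> j) (x j))))
       = sets (\<Pi>\<^sub>M j\<in>J. gamma_law (\<beta> j))"
      by (simp cong: sets_PiM_cong)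
    fix A assume "\<And>j. j \<in> J \<Longrightarrow> A j \<in> sets (gamma_law (\<beta> j))"
    then have A[measurable]: "\<And>j. j \<in> J \<Longrightarrow> A j \<in> sets borel" by simp
    have AJ: "Pi\<^sub>E J A \<in> sets (\<Pi>\<^sub>M j\<in>J. lborel)"
      using A assms(1) by (intro sets_PiM_I_finite) auto
    have "emeasure (density (\<Pi>\<^sub>M j\<in>J. lborel) (\<lambda>x. ennreal (\<Prod>j\<in>J. gamma_dens (\<beta> j) (x j)))) (Pi\<^sub>E J A)
       = (\<integral>\<^sup>+x. ennreal (\<Prod>j\<in>J. gamma_dens (\<beta> j) (x j)) * indicator (Pi\<^sub>E J A) x \<partial>(\<Pi>\<^sub>M j\<in>J. lborel))"
      using AJ by (intro emeasure_density) auto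
    also have "\<dots> = (\<integral>\<^sup>+x. (\<Prod>j\<in>J. ennreal (gamma_dens (\<beta> j) (x j)) * indicator (A j) (x j)) \<partial>(\<Pi>\<^sub>M j\<in>J. lborel))"
    proof (rule nn_integral_cong)
      fix x assume x: "x \<in> space (\<Pi>\<^sub>M j\<in>J. lborel :: real measure)"
      have "indicator (Pi\<^sub>E J A) x = (\<Prod>j\<in>J. indicator (A j) (x j) :: ennreal)"
        using x assms(1) by (auto simp: indicator_def space_PiM PiE_iff prod_zero_iff)
      then show "ennreal (\<Prod>j\<in>J. gamma_dens (\<beta> j) (x j)) * indicator (Pi\<^sub>E J A) x
        = (\<Prod>j\<in>J. ennreal (gamma_dens (\<beta> j) (x j)) * indicator (A j) (x j))"
        by (simp add: prod.distrib prod_ennreal pos)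
    qed
    also have "\<dots> = (\<Prod>j\<in>J. \<integral>\<^sup>+x. ennreal (gamma_dens (\<beta> j) x) * indicator (A j) x \<partial>lborel)"
      using A assms(1) by (intro lborel_PiM.product_nn_integral_prod) measurable
    also have "\<dots> = (\<Prod>j\<in>J. emeasure (gamma_law (\<beta> j)) (A j))"
      using A by (intro prod.cong refl) (simp add: gamma_law_def emeasure_density)
    finally show "emeasure (density (\<Pi>\<^sub>M j\<in>J. lborel) (\<lambda>x. ennreal (\<Prod>j\<in>J. gamma_dens (\<beta> j) (x j)))) (Pi\<^sub>E J A)
       = (\<Prod>j\<in>J. emeasure (gamma_law (\<beta> j)) (A j))" .
  qed
  then show ?thesis by (simp add: \<beta>_def cong: PiM_cong prod.cong)
qed

lemma nn_integral_PiM_lborel_scale: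
  fixes J :: "nat set"
  assumes "finite J" "r > 0" "f \<in> borel_measurable (\<Pi>\<^sub>M j\<in>J. lborel)"
  shows "(\<integral>\<^sup>+x. f x \<partial>(\<Pi>\<^sub>M j\<in>J. lborel))
    = ennreal (r ^ card J) * (\<integral>\<^sup>+x. f (\<lambda>j\<in>J. r * x j) \<partial>(\<Pi>\<^sub>M j\<in>J. lborel))"
  using assms(1,3)
proof (induction J arbitrary: f rule: finite_induct)
  case empty
  show ?case
    by (simp add: lborel_PiM.nn_integral_empty restrict_def del: nn_integral_const)
next
  case (insert k J)
  note [measurable] = insert.prems
  have inner: "(\<integral>\<^sup>+y. f (x(k := y)) \<partial>lborel) = ennreal r * (\<integral>\<^sup>+y. f (x(k := r * y)) \<partial>lborel)"
    if "x \<in> space (\<Pi>\<^sub>M j\<in>J. lborel)" for x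
  proof -
    have "(\<lambda>y. f (x(k := y))) \<in> borel_measurable lborel"
      using that by measurable
    then show ?thesis
      using assms(2) by (subst nn_integral_real_affine[where c = r and t = 0]) auto
  qed
  have "(\<integral>\<^sup>+x. f x \<partial>(\<Pi>\<^sub>M j\<in>insert k J. lborel))
      = (\<integral>\<^sup>+x. (\<integral>\<^sup>+y. f (x(k := y)) \<partial>lborel) \<partial>(\<Pi>\<^sub>M j\<in>J. lborel))"
    using insert by (intro lborel_PiM.product_nn_integral_insert) auto
  also have "\<dots> = (\<integral>\<^sup>+x. ennreal r * (\<integral>\<^sup>+y. f (x(k := r * y)) \<partial>lborel) \<partial>(\<Pi>\<^sub>M j\<in>J. lborel))"
    by (intro nn_integral_cong inner)
  also have "\<dots> = ennreal (r ^ card J) *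
      (\<integral>\<^sup>+x. ennreal r * (\<integral>\<^sup>+y. f ((\<lambda>j\<in>J. r * x j)(k := r * y)) \<partial>lborel) \<partial>(\<Pi>\<^sub>M j\<in>J. lborel))"
    by (rule insert.IH) measurable
  also have "\<dots> = ennreal (r ^ card J) * (ennreal r *
      (\<integral>\<^sup>+x. (\<integral>\<^sup>+y. f ((\<lambda>j\<in>J. r * x j)(k := r * y)) \<partial>lborel) \<partial>(\<Pi>\<^sub>M j\<in>J. lborel)))"
    by (subst nn_integral_cmult) measurable
  also have "(\<integral>\<^sup>+x. (\<integral>\<^sup>+y. f ((\<lambda>j\<in>J. r * x j)(k := r * y)) \<partial>lborel) \<partial>(\<Pi>\<^sub>M j\<in>J. lborel))
      = (\<integral>\<^sup>+x. (\<integral>\<^sup>+y. f (\<lambda>j\<in>insert k J. r * (x(k := y)) j) \<partial>lborel) \<partial>(\<Pi>\<^sub>M j\<in>J. lborel))"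
    using insert.hyps
    by (intro nn_integral_cong arg_cong[where f = f]) (auto simp: fun_eq_iff restrict_def)
  also have "\<dots> = (\<integral>\<^sup>+x. f (\<lambda>j\<in>insert k J. r * x j) \<partial>(\<Pi>\<^sub>M j\<in>insert k J. lborel))"
    using insert.hyps by (intro lborel_PiM.product_nn_integral_insert[symmetric]) auto
  finally show ?case
    using insert.hyps assms(2) by (simp add: ennreal_mult' mult_ac restrict_def)
qed

text \<open>
  The factor \<open>r ^ (p - 1)\<close> is the Jacobian of scaling the first \<open>p - 1\<close> coordinates by \<open>r\<close>; with the
  powers \<open>r powr (\<alpha> j - 1)\<close> of the \<open>p\<close> densities it makes up the exponent \<open>(\<Sum>j=1..p. \<alpha> j) - 1\<close>.
\<close>
lemma gamma_dens_prod_polar: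
  assumes "p \<ge> 1" "\<And>j. j \<in> {1..p} \<Longrightarrow> \<alpha> j > 0" "r > 0"
  shows "r ^ (p - 1) * ((\<Prod>j\<in>{1..<p}. gamma_dens (\<alpha> j) (r * x j)) * gamma_dens (\<alpha> p) (r * simplex_last p x))
    = gamma_dens (\<Sum>j=1..p. \<alpha> j) r * dirichlet_density p \<alpha> x"
proof (cases "(\<forall>j\<in>{1..<p}. 0 < x j) \<and> 0 < simplex_last p x")
  case True
  let ?J = "{1..<p}" and ?l = "simplex_last p x"
  have split_p: "{1..p} = insert p ?J" using assms(1) by auto
  have J: "\<alpha> j > 0" if "j \<in> ?J" for j using that assms(2)[of j] by auto
  have p: "\<alpha> p > 0" using assms by auto
  have e: "(\<Prod>j\<in>?J. exp (- (r * x j) / 2)) * exp (- (r * ?l) / 2) = exp (- r / 2)"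
    by (simp add: exp_sum[symmetric] simplex_last_def sum_negf sum_distrib_left[symmetric]
        sum_divide_distrib[symmetric] algebra_simps diff_divide_distrib flip: exp_add)
  have c: "(\<Prod>j\<in>?J. 2 powr \<alpha> j) * 2 powr \<alpha> p = 2 powr (\<Sum>j=1..p. \<alpha> j)"
    unfolding split_p by (simp add: powr_sum powr_add)
  have rr: "r ^ (p - 1) * ((\<Prod>j\<in>?J. r powr (\<alpha> j - 1)) * r powr (\<alpha> p - 1)) = r powr ((\<Sum>j=1..p. \<alpha> j) - 1)"
  proof -
    have "r powr ((\<Sum>j=1..p. \<alpha> j) - 1) = r powr (real (p - 1) + ((\<Sum>j\<in>?J. \<alpha> j - 1) + (\<alpha> p - 1)))"
      by (rule arg_cong[where f = "\<lambda>s. r powr s"]) (simp only: split_p, simp add: sum_subtractf)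
    also have "\<dots> = r ^ (p - 1) * ((\<Prod>j\<in>?J. r powr (\<alpha> j - 1)) * r powr (\<alpha> p - 1))"
      using assms(3) by (simp add: powr_add powr_sum powr_realpow)
    finally show ?thesis ..
  qed
  have "(\<Prod>j\<in>?J. gamma_dens (\<alpha> j) (r * x j)) * gamma_dens (\<alpha> p) (r * ?l)
      = (\<Prod>j\<in>?J. r powr (\<alpha> j - 1) * x j powr (\<alpha> j - 1) * exp (- (r * x j) / 2) / (2 powr \<alpha> j * Gamma (\<alpha> j)))
        * (r powr (\<alpha> p - 1) * ?l powr (\<alpha> p - 1) * exp (- (r * ?l) / 2) / (2 powr \<alpha> p * Gamma (\<alpha> p)))"
    using True assms(3) by (intro arg_cong2[where f = "(*)"] prod.cong) (auto simp: gamma_dens_def powr_mult)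
  also have "\<dots> = ((\<Prod>j\<in>?J. r powr (\<alpha> j - 1)) * r powr (\<alpha> p - 1))
      * ((\<Prod>j\<in>?J. x j powr (\<alpha> j - 1)) * ?l powr (\<alpha> p - 1))
      * ((\<Prod>j\<in>?J. exp (- (r * x j) / 2)) * exp (- (r * ?l) / 2))
      / (((\<Prod>j\<in>?J. 2 powr \<alpha> j) * 2 powr \<alpha> p) * ((\<Prod>j\<in>?J. Gamma (\<alpha> j)) * Gamma (\<alpha> p)))"
    by (simp add: prod.distrib prod_dividef mult_ac)
  finally have "r ^ (p - 1) * ((\<Prod>j\<in>?J. gamma_dens (\<alpha> j) (r * x j)) * gamma_dens (\<alpha> p) (r * ?l))
      = r powr ((\<Sum>j=1..p. \<alpha> j) - 1) * ((\<Prod>j\<in>?J. x j powr (\<alpha> j - 1)) * ?l powr (\<alpha> p - 1)) * exp (- r / 2)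
      / (2 powr (\<Sum>j=1..p. \<alpha> j) * (\<Prod>j=1..p. Gamma (\<alpha> j)))"
    unfolding e c rr[symmetric] by (simp only: split_p) (simp add: mult_ac)
  moreover have "Gamma (\<Sum>j=1..p. \<alpha> j) > 0"
    using assms by (intro Gamma_real_pos sum_pos) auto
  ultimately show ?thesis
    using True assms(3) by (simp add: gamma_dens_def dirichlet_density_def)
next
  case False
  then have "(\<exists>j\<in>{1..<p}. gamma_dens (\<alpha> j) (r * x j) = 0) \<or> gamma_dens (\<alpha> p) (r * simplex_last p x) = 0"
    using assms(3) by (auto simp: gamma_dens_def zero_less_mult_iff)
  then show ?thesis using False by (auto simp: dirichlet_density_def prod_zero_iff)
qed

lemma simplex_last_measurable [measurable]:
  "simplex_last p \<in> borel_measurable (\<Pi>\<^sub>M j\<in>{1..<p}. lborel)"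
  unfolding simplex_last_def by measurable

lemma dirichlet_density_measurable [measurable]:
  "dirichlet_density p \<alpha> \<in> borel_measurable (\<Pi>\<^sub>M j\<in>{1..<p}. lborel)"
  unfolding dirichlet_density_def by measurable

text \<open>
  In the product of the gamma densities the last coordinate is replaced by the total \<open>r\<close>, by a translation
  when the others are fixed. After exchanging the integrals, the other coordinates are divided by \<open>r\<close>. By
  \<open>gamma_dens_prod_polar\<close> the integrand is then a product of the gamma density of the total
  and the Dirichlet density, and the total integrates to one.
\<close>
lemma dirichlet_eq_normalized_gamma:
  assumes "p \<ge> 1" "\<And>j. j \<in> {1..p} \<Longrightarrow> \<alpha> j > 0"
  shows "dirichlet p \<alpha> = distr (\<Pi>\<^sub>M j\<in>{1..p}. gamma_law (\<alpha> j)) (\<Pi>\<^sub>M j\<in>{1..p}. borel)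
    (\<lambda>x. \<lambda>j\<in>{1..p}. x j / (\<Sum>i=1..p. x i))" (is "?L = ?R")
proof (rule measure_eqI[symmetric])
  note [simp del] = One_nat_def
  show "sets ?R = sets ?L" by (simp add: dirichlet_def)
  fix A assume "A \<in> sets ?R"
  then have A[measurable]: "A \<in> sets (\<Pi>\<^sub>M j\<in>{1..p}. borel)" by simp
  let ?J = "{1..<p}" and ?P = "\<Pi>\<^sub>M j\<in>{1..<p}. lborel :: real measure" and ?s = "\<Sum>j=1..p. \<alpha> j"
  define emb where "emb x = (\<lambda>j\<in>{1..p}. if j = p then simplex_last p x else x j)" for x
  define F where "F = (\<lambda>x. indicator A (\<lambda>j\<in>{1..p}. x j / (\<Sum>i=1..p. x i)) :: ennreal)"
  define g where "g = (\<lambda>y t. ennreal ((\<Prod>j\<in>?J. gamma_dens (\<alpha> j) (y j)) * gamma_dens (\<alpha> p) t))"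
  have split_p: "{1..p} = insert p ?J" and pJ: "p \<notin> ?J" using assms(1) by auto
  have pos: "\<alpha> j > 0" if "j \<in> ?J" for j using that assms(2)[of j] by auto
  have pos_p: "\<alpha> p > 0" using assms by auto
  have pos_s: "?s > 0" using assms by (intro sum_pos) auto
  interpret G: prob_space "gamma_law ?s" by (rule prob_space_gamma_law[OF pos_s])
  interpret PJ: sigma_finite_measure ?P
    by (rule lborel_PiM.sigma_finite) simp
  interpret pair_sigma_finite ?P "lborel :: real measure" ..
  have emb[measurable]: "emb \<in> ?P \<rightarrow>\<^sub>M (\<Pi>\<^sub>M j\<in>{1..p}. borel)"
    unfolding emb_def
  proof (rule measurable_restrict)
    fix j assume "j \<in> {1..p}"
    then show "(\<lambda>x. if j = p then simplex_last p x else x j) \<in> borel_measurable ?P"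
      using simplex_last_measurable[of p]
      by (cases "j = p") (auto intro!: measurable_component_singleton)
  qed
  have Fm[measurable]: "F \<in> borel_measurable (\<Pi>\<^sub>M j\<in>insert p ?J. lborel)"
    unfolding F_def split_p[symmetric] by measurable
  have prods: "(\<Prod>j=1..p. gamma_dens (\<alpha> j) ((y(p := t)) j)) = (\<Prod>j\<in>?J. gamma_dens (\<alpha> j) (y j)) * gamma_dens (\<alpha> p) t" for y t
    unfolding split_p using pJ by (subst prod.insert) (auto simp: mult.commute intro!: prod.cong)
  have gm[measurable]: "(\<lambda>(y, t). g y t) \<in> borel_measurable (?P \<Otimes>\<^sub>M lborel)"
    unfolding g_def by measurable
  have FFm[measurable]: "(\<lambda>(y, t). F (y(p := t))) \<in> borel_measurable (?P \<Otimes>\<^sub>M lborel)"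
    by measurable
  have "emeasure ?R A = (\<integral>\<^sup>+x. F x \<partial>(\<Pi>\<^sub>M j\<in>{1..p}. gamma_law (\<alpha> j)))"
    unfolding F_def by (subst nn_integral_indicator[symmetric, of A ?R])
      (simp_all add: nn_integral_distr del: nn_integral_indicator)
  also have "\<dots> = (\<integral>\<^sup>+x. ennreal (\<Prod>j=1..p. gamma_dens (\<alpha> j) (x j)) * F x \<partial>(\<Pi>\<^sub>M j\<in>{1..p}. lborel))"
    using Fm unfolding split_p[symmetric]
    by (subst gamma_PiM_density[OF _ assms(2)]) (auto simp: nn_integral_density)
  also have "\<dots> = (\<integral>\<^sup>+y. \<integral>\<^sup>+t. g y t * F (y(p := t)) \<partial>lborel \<partial>?P)"
    unfolding g_def prods[symmetric] unfolding split_p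
    by (rule lborel_PiM.product_nn_integral_insert[OF _ pJ]) auto
  also have "\<dots> = (\<integral>\<^sup>+y. \<integral>\<^sup>+r. g y (r - (\<Sum>j\<in>?J. y j)) * F (y(p := r - (\<Sum>j\<in>?J. y j))) \<partial>lborel \<partial>?P)"
  proof (rule nn_integral_cong)
    fix y assume y: "y \<in> space ?P"
    have "(\<lambda>t. g y t * F (y(p := t))) \<in> borel_measurable borel"
      using measurable_compose_Pair1[OF y gm] measurable_compose_Pair1[OF y FFm] by simp
    then show "(\<integral>\<^sup>+t. g y t * F (y(p := t)) \<partial>lborel)
      = (\<integral>\<^sup>+r. g y (r - (\<Sum>j\<in>?J. y j)) * F (y(p := r - (\<Sum>j\<in>?J. y j))) \<partial>lborel)"
      by (subst nn_integral_real_affine[where c = 1 and t = "- (\<Sum>j\<in>?J. y j)"]) simp_all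
  qed
  also have "\<dots> = (\<integral>\<^sup>+r. \<integral>\<^sup>+y. g y (r - (\<Sum>j\<in>?J. y j)) * F (y(p := r - (\<Sum>j\<in>?J. y j))) \<partial>?P \<partial>lborel)"
    unfolding g_def by (rule Fubini'[symmetric]) measurable
  also have "\<dots> = (\<integral>\<^sup>+r. \<integral>\<^sup>+x. ennreal (gamma_dens ?s r) * (ennreal (dirichlet_density p \<alpha> x) * indicator A (emb x)) \<partial>?P \<partial>lborel)"
  proof (rule nn_integral_cong)
    fix r :: real
    show "(\<integral>\<^sup>+y. g y (r - (\<Sum>j\<in>?J. y j)) * F (y(p := r - (\<Sum>j\<in>?J. y j))) \<partial>?P)
      = (\<integral>\<^sup>+x. ennreal (gamma_dens ?s r) * (ennreal (dirichlet_density p \<alpha> x) * indicator A (emb x)) \<partial>?P)"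
    proof (cases "r > 0")
      case False
      have "g y (r - (\<Sum>j\<in>?J. y j)) = 0" for y
      proof (cases "\<forall>j\<in>?J. 0 < y j")
        case True
        then have "r - (\<Sum>j\<in>?J. y j) \<le> 0"
          using False sum_nonneg[of ?J y] by (smt (verit))
        then show ?thesis by (simp add: g_def gamma_dens_def)
      next
        case False
        then have "(\<Prod>j\<in>?J. gamma_dens (\<alpha> j) (y j)) = 0"
          by (subst prod_zero_iff) (auto simp: gamma_dens_def)
        then show ?thesis by (simp only: g_def mult_zero_left ennreal_0)
      qed
      then show ?thesis using False by (simp add: gamma_dens_def)
    next
      case True
      have last: "r - (\<Sum>j\<in>?J. (\<lambda>j\<in>?J. r * x j) j) = r * simplex_last p x" for x
        by (simp add: simplex_last_def sum_distrib_left algebra_simps)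
      have F_scale: "F ((\<lambda>j\<in>?J. r * x j)(p := r * simplex_last p x)) = indicator A (emb x)" for x
      proof -
        let ?z = "(\<lambda>j\<in>?J. r * x j)(p := r * simplex_last p x)"
        have "(\<Sum>i=1..p. ?z i) = r * simplex_last p x + (\<Sum>j\<in>?J. r * x j)"
          unfolding split_p using pJ by (subst sum.insert) (auto intro!: sum.cong)
        also have "\<dots> = r" by (simp add: simplex_last_def sum_distrib_left algebra_simps)
        finally have total: "(\<Sum>i=1..p. ?z i) = r" .
        have "(\<lambda>j\<in>{1..p}. ?z j / r) = emb x"
          using True by (auto simp: emb_def fun_eq_iff restrict_def)
        then show ?thesis unfolding F_def total by simp
      qed
      have "(\<integral>\<^sup>+y. g y (r - (\<Sum>j\<in>?J. y j)) * F (y(p := r - (\<Sum>j\<in>?J. y j))) \<partial>?P)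
        = ennreal (r ^ card ?J) * (\<integral>\<^sup>+x. g (\<lambda>j\<in>?J. r * x j) (r * simplex_last p x) * indicator A (emb x) \<partial>?P)"
        unfolding F_scale[symmetric] last[symmetric]
        by (rule nn_integral_PiM_lborel_scale[OF _ True]) (auto simp: g_def)
      also have "\<dots> = (\<integral>\<^sup>+x. ennreal (r ^ (p - 1)) * (g (\<lambda>j\<in>?J. r * x j) (r * simplex_last p x) * indicator A (emb x)) \<partial>?P)"
        by (subst nn_integral_cmult) (simp_all add: g_def)
      also have "\<dots> = (\<integral>\<^sup>+x. ennreal (gamma_dens ?s r) * (ennreal (dirichlet_density p \<alpha> x) * indicator A (emb x)) \<partial>?P)"
      proof (rule nn_integral_cong)
        fix x
        have "ennreal (r ^ (p - 1)) * g (\<lambda>j\<in>?J. r * x j) (r * simplex_last p x)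
          = ennreal (r ^ (p - 1) * ((\<Prod>j\<in>?J. gamma_dens (\<alpha> j) (r * x j)) * gamma_dens (\<alpha> p) (r * simplex_last p x)))"
          using True by (simp add: g_def ennreal_mult')
        also have "r ^ (p - 1) * ((\<Prod>j\<in>?J. gamma_dens (\<alpha> j) (r * x j)) * gamma_dens (\<alpha> p) (r * simplex_last p x))
            = gamma_dens ?s r * dirichlet_density p \<alpha> x"
          by (rule gamma_dens_prod_polar[OF assms True])
        also have "ennreal (gamma_dens ?s r * dirichlet_density p \<alpha> x)
            = ennreal (gamma_dens ?s r) * ennreal (dirichlet_density p \<alpha> x)"
          using pos_s by (simp add: ennreal_mult')
        finally show "ennreal (r ^ (p - 1)) * (g (\<lambda>j\<in>?J. r * x j) (r * simplex_last p x) * indicator A (emb x))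
          = ennreal (gamma_dens ?s r) * (ennreal (dirichlet_density p \<alpha> x) * indicator A (emb x))"
          by (simp only: mult.assoc[symmetric])
      qed
      finally show ?thesis .
    qed
  qed
  also have "\<dots> = (\<integral>\<^sup>+r. ennreal (gamma_dens ?s r) * (\<integral>\<^sup>+x. ennreal (dirichlet_density p \<alpha> x) * indicator A (emb x) \<partial>?P) \<partial>lborel)"
    by (intro nn_integral_cong nn_integral_cmult) measurable
  also have "\<dots> = (\<integral>\<^sup>+r. ennreal (gamma_dens ?s r) \<partial>lborel) * (\<integral>\<^sup>+x. ennreal (dirichlet_density p \<alpha> x) * indicator A (emb x) \<partial>?P)"
    by (rule nn_integral_multc) measurable
  also have "(\<integral>\<^sup>+r. ennreal (gamma_dens ?s r) \<partial>lborel) = 1"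
    using G.emeasure_space_1 by (simp add: gamma_law_def emeasure_density)
  also have "1 * (\<integral>\<^sup>+x. ennreal (dirichlet_density p \<alpha> x) * indicator A (emb x) \<partial>?P) = emeasure ?L A"
    unfolding dirichlet_def emb_def[symmetric]
    by (subst nn_integral_indicator[symmetric, of A])
      (simp_all add: nn_integral_distr nn_integral_density del: nn_integral_indicator)
  finally show "emeasure ?R A = emeasure ?L A" .
qed

section \<open>The law of the Pearson divergence\<close>

lemma pearson_divergence_eq:
  assumes "prob_vector p w" "\<And>j. j \<in> {1..p} \<Longrightarrow> s j > 0" "(\<Sum>j=1..p. s j) = 1"
  shows "pearson_divergence p w s = (\<Sum>j=1..p. (w j)\<^sup>2 / s j) - 1"
proof -
  have "pearson_divergence p w s = (\<Sum>j=1..p. (w j)\<^sup>2 / s j - 2 * w j + s j)"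
    unfolding pearson_divergence_def
  proof (rule sum.cong[OF refl])
    fix j assume "j \<in> {1..p}"
    then show "(w j - s j)\<^sup>2 / s j = (w j)\<^sup>2 / s j - 2 * w j + s j"
      using assms(2)[of j] by (simp add: power2_eq_square field_simps)
  qed
  also have "\<dots> = (\<Sum>j=1..p. (w j)\<^sup>2 / s j) - 2 * (\<Sum>j=1..p. w j) + (\<Sum>j=1..p. s j)"
    by (simp add: sum.distrib sum_subtractf sum_distrib_left)
  finally show ?thesis using assms by (simp add: prob_vector_def)
qed

text \<open>
  With all the weight on the coordinate \<open>x\<close>, and with \<open>y\<close> the sum of the other ones, the divergence
  \<open>Q * L - 1\<close> is \<open>(x + y) / x - 1 = y / x\<close>.
\<close>
lemma pearson_divergence_dirichlet_half:
  assumes "p \<ge> 2" "prob_vector p w"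
  shows "distr (dirichlet p (\<lambda>_. 1/2)) borel (pearson_divergence p w)
    = distr (gamma_law ((real p - 1) / 2) \<Otimes>\<^sub>M gamma_law (1/2)) borel (\<lambda>(x, y). x / y)"
proof -
  note [simp del] = One_nat_def
  let ?P = "\<Pi>\<^sub>M j\<in>{1..p}. gamma_law (1/2)" and ?G = "gamma_law ((real p - 1) / 2)" and ?H = "gamma_law (1/2)"
  interpret G: prob_space ?G using assms(1) by (intro prob_space_gamma_law) auto
  interpret H: prob_space ?H by (rule prob_space_gamma_law) simp
  interpret P: pair_prob_space ?H ?G ..
  have D[measurable]: "pearson_divergence p w \<in> borel_measurable (\<Pi>\<^sub>M j\<in>{1..p}. borel)"
    unfolding pearson_divergence_def by measurable
  have ql: "(\<lambda>(q, l). q * l - 1 :: real) \<in> borel_measurable borel"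
    by (subst borel_prod[symmetric]) measurable
  have pos: "AE x in ?P. \<forall>j\<in>{1..p}. 0 < x j"
    by (rule AE_finite_allI) (auto intro!: AE_PiM_component prob_space_gamma_law AE_gamma_law_pos)
  have "distr (dirichlet p (\<lambda>_. 1/2)) borel (pearson_divergence p w)
     = distr ?P borel (\<lambda>x. pearson_divergence p w (\<lambda>j\<in>{1..p}. x j / (\<Sum>i=1..p. x i)))"
    using assms(1) by (subst dirichlet_eq_normalized_gamma) (auto simp: distr_distr comp_def)
  also have "\<dots> = distr ?P borel (\<lambda>x. (\<Sum>j=1..p. x j) * (\<Sum>j=1..p. (w j)\<^sup>2 / x j) - 1)"
  proof (rule distr_cong_AE)
    show "AE x in ?P. pearson_divergence p w (\<lambda>j\<in>{1..p}. x j / (\<Sum>i=1..p. x i))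
        = (\<Sum>j=1..p. x j) * (\<Sum>j=1..p. (w j)\<^sup>2 / x j) - 1"
      using pos
    proof eventually_elim
      case (elim x)
      then have q: "(\<Sum>i=1..p. x i) > 0" using assms(1) by (intro sum_pos) auto
      then have "pearson_divergence p w (\<lambda>j\<in>{1..p}. x j / (\<Sum>i=1..p. x i))
         = (\<Sum>j=1..p. (w j)\<^sup>2 / (x j / (\<Sum>i=1..p. x i))) - 1"
        using elim by (subst pearson_divergence_eq[OF assms(2)]) (auto simp: sum_divide_distrib[symmetric])
      then show ?case by (simp add: sum_distrib_left mult.commute)
    qed
  qed measurable
  also have "\<dots> = distr (weighted_sums_law {1..p} w) borel (\<lambda>(q, l). q * l - 1)"
    unfolding weighted_sums_law_def by (subst distr_distr[OF ql]) (auto simp: comp_def)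
  also have "\<dots> = distr (?H \<Otimes>\<^sub>M ?G) borel (\<lambda>(x, y). (x + y) * (1 / x) - 1)"
    unfolding weighted_sums_law_prob_vector[OF assms]
    by (subst distr_distr[OF ql]) (auto simp: comp_def case_prod_beta')
  also have "\<dots> = distr (?H \<Otimes>\<^sub>M ?G) borel (\<lambda>(x, y). y / x)"
  proof (rule distr_cong_AE)
    have "AE z in ?H \<Otimes>\<^sub>M ?G. 0 < fst z \<and> 0 < snd z"
      using assms(1) by (intro AE_gamma_law_pair_pos) auto
    then show "AE z in ?H \<Otimes>\<^sub>M ?G. (case z of (x, y) \<Rightarrow> (x + y) * (1 / x) - 1) = (case z of (x, y) \<Rightarrow> y / x)"
      by eventually_elim (auto simp: field_simps)
  qed simp_all
  also have "\<dots> = distr (distr (?G \<Otimes>\<^sub>M ?H) (?H \<Otimes>\<^sub>M ?G) (\<lambda>(x, y). (y, x))) borel (\<lambda>(x, y). y / x)"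
    using P.distr_pair_swap by simp
  also have "\<dots> = distr (?G \<Otimes>\<^sub>M ?H) borel (\<lambda>(x, y). x / y)"
    by (subst distr_distr) (auto simp: comp_def case_prod_beta')
  finally show ?thesis .
qed

theorem corollary9p2:
  fixes M :: "'a measure" and p :: nat and S :: "nat \<Rightarrow> 'a \<Rightarrow> real" and w :: "nat \<Rightarrow> real"
  assumes "prob_space M"
    and "p \<ge> 2"
    and "\<And>j. j \<in> {1..p} \<Longrightarrow> S j \<in> borel_measurable M"
    and "distr M (\<Pi>\<^sub>M j\<in>{1..p}. borel) (\<lambda>\<omega>. \<lambda>j\<in>{1..p}. S j \<omega>) = dirichlet p (\<lambda>_. 1 / 2)"
    and "prob_vector p w"
  shows "distr M borel (\<lambda>\<omega>. pearson_divergence p w (\<lambda>j. S j \<omega>))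
           = beta_prime_distribution ((real p - 1) / 2) (1 / 2)
       \<and> beta_prime_distribution ((real p - 1) / 2) (1 / 2)
           = chi_square_ratio_distribution (p - 1) 1
       \<and> chi_square_ratio_distribution (p - 1) 1
           = distr (F_distribution (p - 1) 1) borel (\<lambda>x. (real p - 1) * x)"
proof (intro conjI)
  let ?D = "pearson_divergence p w"
  have D: "?D \<in> borel_measurable (\<Pi>\<^sub>M j\<in>{1..p}. borel)"
    unfolding pearson_divergence_def by measurable
  have S: "(\<lambda>\<omega>. \<lambda>j\<in>{1..p}. S j \<omega>) \<in> M \<rightarrow>\<^sub>M (\<Pi>\<^sub>M j\<in>{1..p}. borel)"
    using assms(3) by (rule measurable_restrict)
  have "distr M borel (\<lambda>\<omega>. ?D (\<lambda>j. S j \<omega>)) = distr M borel (\<lambda>\<omega>. ?D (\<lambda>j\<in>{1..p}. S j \<omega>))"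
    by (simp add: pearson_divergence_def)
  also have "\<dots> = distr (dirichlet p (\<lambda>_. 1 / 2)) borel ?D"
    unfolding assms(4)[symmetric] by (subst distr_distr[OF D S]) (simp add: comp_def)
  finally show "distr M borel (\<lambda>\<omega>. ?D (\<lambda>j. S j \<omega>)) = beta_prime_distribution ((real p - 1) / 2) (1 / 2)"
    using assms(2) by (simp add: pearson_divergence_dirichlet_half[OF assms(2,5)] beta_prime_eq_gamma_ratio)
  show "beta_prime_distribution ((real p - 1) / 2) (1 / 2) = chi_square_ratio_distribution (p - 1) 1"
    using assms(2) by (simp add: beta_prime_eq_gamma_ratio chi_square_ratio_distribution_def
        chi_square_eq_gamma_law of_nat_diff)
  show "chi_square_ratio_distribution (p - 1) 1
      = distr (F_distribution (p - 1) 1) borel (\<lambda>x. (real p - 1) * x)"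
    using assms(2) chi_square_ratio_eq_scaled_F[of "p - 1"] by (simp add: of_nat_diff)
qed

end
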